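(* Let $T$ be a semiprime Lie triple system over a field $\mathbf{F}$ and let $S$ be a system of quotients of $T$. Then the standard embedding $L(S)=S\oplus\mathcal{L}(S,S)$ is an algebra of quotients of the Lie algebra $L(T)=T\oplus\mathcal{L}(T,T)$. Moreover, if $T$ is nondegenerate and the characteristic of $\mathbf{F}$ is neither $2$ nor $3$, then $S$ is also nondegenerate.
   Context: $\mathbf{F}$ is a field of arbitrary characteristic. A Lie triple system (LTS) over $\mathbf{F}$ is a vector space $T$ with a trilinear map $(x,y,z)\mapsto[x,y,z]$ such that $[x,x,z]=0$, $[x,y,z]+[y,z,x]+[z,x,y]=0$, and $[u,v,[x,y,z]]=[[u,v,x],y,z]+[x,[u,v,y],z]+[x,y,[u,v,z]]$ for all $x,y,z,u,v\in T$. A subsystem of $T$ is a subspace $I$ with $[I,I,I]\subseteq I$; an ideal of $T$ is a subspace $I$ with $[I,T,T]\subseteq I$. Brackets of subspaces denote the linear span of the corresponding brackets of elements; an element in such a bracket stands for itself. $T$ is semiprime if $[T,I,I]\neq0$ for every nonzero ideal $I$ of $T$; $T$ is nondegenerate if $[T,x,x]\neq0$ for every nonzero $x\in T$. Let $T$ be a subsystem of an LTS $S$. Define $R(x,y)(z)=[z,x,y]$ for $x,y,z\in S$. For $s\in S$, let ${}_T(s)$ be the linear span in $S$ of $s$ and all elements $R(x_1,y_1)\cdots R(x_n,y_n)(s)$ with $n\in\mathbb{N}$ and $x_i,y_i\in T$, and let $(T:s)=\{x\in T\mid [x,T,{}_T(s)]+[x,{}_T(s),T]\subseteq T\}$. $S$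 is a system of quotients of $T$ if for all $s,s'\in S$ with $s\neq 0$ there exist $x,y\in T$ such that $[s,x,y]\neq 0$ and ($x\in (T:s')$ or $y\in (T:s')$). Standard embedding: for an LTS $T$, let $\mathcal{L}(x,y)(z)=[x,y,z]$ and let $\mathcal{L}(T,T)$ be the $\mathbf{F}$-span of the operators $\mathcal{L}(x,y):T\to T$, $x,y\in T$. The standard embedding is the $\mathbb{Z}_2$-graded Lie algebra $L(T)=L_0\oplus L_1$ with $L_0=\mathcal{L}(T,T)$, $L_1=T$ and product $$[(\mathcal{L}(x,y),z),(\mathcal{L}(u,v),w)]=(\mathcal{L}([u,v,y],x)-\mathcal{L}([u,v,x],y)+\mathcal{L}(z,w),\ [x,y,w]-[u,v,z]).$$ When $S$ is a system of quotients of $T$, $L(T)$ is regarded as a subalgebra of $L(S)$ via $x+\sum_i\mathcal{L}(a_i,b_i)|_T\mapsto x+\sum_i\mathcal{L}(a_i,b_i)$ ($x,a_i,b_i\in T$), where on the right the operators act on $S$. Let $L\subseteq Q$ be an extension of Lie algebras. $Q$ is an algebra of quotients of $L$ if the following (known to be equivalent) conditions hold: (i) for all $p,q\in Q$ with $p\neq0$ there is $x\in L$ with $[x,p]\neq0$ and $[x,{}_L(q)]\subseteq L$, where ${}_L(q)$ is the linear span in $Q$ of $q$ and the elements $\mathrm{ad}\,x_1\cdots\mathrm{ad}\,x_n\, q$ with $n\in\mathbb{N}$, $x_i\in L$; (ii) for every nonzero $q\in Q$ there is an ideal $I$ of $L$ with $C_L(I)=\{x\in L\mid [x,I]=0\}=0$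 and $0\neq[I,q]\subseteq L$. *)

theory Defs
  imports Complex_Main "HOL-Library.Function_Algebras" "HOL-Library.Product_Plus"
begin

section \<open>Lie triple systems\<close>

text \<open>
  The locale describes the big system \<open>S\<close>, whose underlying vector space is the whole type
  \<open>'a\<close>. Every notion for a system \<open>T\<close> is stated for a subset of \<open>S\<close> (intended to be a
  subsystem); \<open>S\<close> itself is the case \<open>T = UNIV\<close>.
\<close>

locale lie_triple_system = vector_space scale
  for scale :: "'f::field \<Rightarrow> 'a::ab_group_add \<Rightarrow> 'a" +
  fixes br :: "'a \<Rightarrow> 'a \<Rightarrow> 'a \<Rightarrow> 'a"
  assumes linear_1: "Vector_Spaces.linear scale scale (\<lambda>x. br x y z)"
    and linear_2: "Vector_Spaces.linear scale scale (\<lambda>y. br x y z)"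
    and linear_3: "Vector_Spaces.linear scale scale (\<lambda>z. br x y z)"
    and alternating: "br x x z = 0"
    and cyclic: "br x y z + br y z x + br z x y = 0"
    and derivation: "br u v (br x y z) =
          br (br u v x) y z + br x (br u v y) z + br x y (br u v z)"
begin

definition bracket :: "'a set \<Rightarrow> 'a set \<Rightarrow> 'a set \<Rightarrow> 'a set" where
  "bracket A B C = span {br a b c | a b c. a \<in> A \<and> b \<in> B \<and> c \<in> C}"

definition subsystem :: "'a set \<Rightarrow> bool" where
  "subsystem I \<longleftrightarrow> subspace I \<and> bracket I I I \<subseteq> I"

definition ideal_of :: "'a set \<Rightarrow> 'a set \<Rightarrow> bool" where
  "ideal_of I T \<longleftrightarrow> subspace I \<and> I \<subseteq> T \<and> bracket I T T \<subseteq> I"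

definition semiprime :: "'a set \<Rightarrow> bool" where
  "semiprime T \<longleftrightarrow> (\<forall>I. ideal_of I T \<longrightarrow> I \<noteq> {0} \<longrightarrow> bracket T I I \<noteq> {0})"

definition nondegenerate :: "'a set \<Rightarrow> bool" where
  "nondegenerate T \<longleftrightarrow> (\<forall>x\<in>T. x \<noteq> 0 \<longrightarrow> bracket T {x} {x} \<noteq> {0})"

definition rmult :: "'a \<Rightarrow> 'a \<Rightarrow> 'a \<Rightarrow> 'a" where
  "rmult x y z = br z x y"

text \<open>The empty word gives the element \<open>s\<close> itself.\<close>

definition generated :: "'a set \<Rightarrow> 'a \<Rightarrow> 'a set" where
  "generated T s = span {foldr (\<lambda>(x, y). rmult x y) ps s | ps. set ps \<subseteq> T \<times> T}"

definition colon :: "'a set \<Rightarrow> 'a \<Rightarrow> 'a set" where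
  "colon T s = {x \<in> T. {a + b | a b.
     a \<in> bracket {x} T (generated T s) \<and> b \<in> bracket {x} (generated T s) T} \<subseteq> T}"

definition system_of_quotients :: "'a set \<Rightarrow> bool" where
  "system_of_quotients T \<longleftrightarrow> (\<forall>s s'. s \<noteq> 0 \<longrightarrow>
     (\<exists>x\<in>T. \<exists>y\<in>T. br s x y \<noteq> 0 \<and> (x \<in> colon T s' \<or> y \<in> colon T s')))"

end


section \<open>Lie algebras and algebras of quotients\<close>

text \<open>The Lie algebra lives on a subspace \<open>Q\<close> of the ambient vector space.\<close>

locale lie_algebra = vector_space scale
  for scale :: "'f::field \<Rightarrow> 'b::ab_group_add \<Rightarrow> 'b" +
  fixes Q :: "'b set" and lbr :: "'b \<Rightarrow> 'b \<Rightarrow> 'b"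
  assumes subspace_Q: "subspace Q"
    and closed: "x \<in> Q \<Longrightarrow> y \<in> Q \<Longrightarrow> lbr x y \<in> Q"
    and add_left: "x \<in> Q \<Longrightarrow> y \<in> Q \<Longrightarrow> z \<in> Q \<Longrightarrow> lbr (x + y) z = lbr x z + lbr y z"
    and add_right: "x \<in> Q \<Longrightarrow> y \<in> Q \<Longrightarrow> z \<in> Q \<Longrightarrow> lbr x (y + z) = lbr x y + lbr x z"
    and scale_left: "x \<in> Q \<Longrightarrow> y \<in> Q \<Longrightarrow> lbr (scale c x) y = scale c (lbr x y)"
    and scale_right: "x \<in> Q \<Longrightarrow> y \<in> Q \<Longrightarrow> lbr x (scale c y) = scale c (lbr x y)"
    and alternating: "x \<in> Q \<Longrightarrow> lbr x x = 0"
    and jacobi: "x \<in> Q \<Longrightarrow> y \<in> Q \<Longrightarrow> z \<in> Q \<Longrightarrow>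
          lbr x (lbr y z) + lbr y (lbr z x) + lbr z (lbr x y) = 0"
begin

definition lbracket :: "'b set \<Rightarrow> 'b set \<Rightarrow> 'b set" where
  "lbracket A B = span {lbr a b | a b. a \<in> A \<and> b \<in> B}"

definition subalgebra :: "'b set \<Rightarrow> bool" where
  "subalgebra L \<longleftrightarrow> subspace L \<and> L \<subseteq> Q \<and> lbracket L L \<subseteq> L"

definition lie_ideal_of :: "'b set \<Rightarrow> 'b set \<Rightarrow> bool" where
  "lie_ideal_of I L \<longleftrightarrow> subspace I \<and> I \<subseteq> L \<and> lbracket I L \<subseteq> I"

definition centralizer :: "'b set \<Rightarrow> 'b set \<Rightarrow> 'b set" where
  "centralizer L I = {x \<in> L. lbracket {x} I = {0}}"

text \<open>The empty word gives the element \<open>q\<close> itself.\<close>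

definition ad_generated :: "'b set \<Rightarrow> 'b \<Rightarrow> 'b set" where
  "ad_generated L q = span {foldr lbr xs q | xs. set xs \<subseteq> L}"

end

locale algebra_of_quotients = lie_algebra scale Q lbr
  for scale :: "'f::field \<Rightarrow> 'b::ab_group_add \<Rightarrow> 'b" and Q and lbr +
  fixes L :: "'b set"
  assumes subalgebra_L: "subalgebra L"
    and quotients: "p \<in> Q \<Longrightarrow> q \<in> Q \<Longrightarrow> p \<noteq> 0 \<Longrightarrow>
          \<exists>x\<in>L. lbr x p \<noteq> 0 \<and> lbracket {x} (ad_generated L q) \<subseteq> L"

context lie_algebra
begin

lemma zero_left: "y \<in> Q \<Longrightarrow> lbr 0 y = 0"
  using scale_left[of 0 y 0] subspace_0[OF subspace_Q] by simp

lemma zero_right: "y \<in> Q \<Longrightarrow> lbr y 0 = 0"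
  using scale_right[of y 0 0] subspace_0[OF subspace_Q] by simp

lemma anticomm:
  assumes "x \<in> Q" "y \<in> Q" shows "lbr x y = - lbr y x"
proof -
  have xy: "x + y \<in> Q" using assms subspace_add subspace_Q by blast
  have "0 = lbr (x + y) (x + y)" using xy alternating by simp
  also have "\<dots> = lbr x y + lbr y x"
    using alternating[OF assms(1)] alternating[OF assms(2)] assms xy
    by (simp add: add_left add_right)
  finally show ?thesis by (metis eq_neg_iff_add_eq_0)
qed

lemma jacobi':
  assumes "x \<in> Q" "y \<in> Q" "z \<in> Q"
  shows "lbr x (lbr y z) = lbr (lbr x y) z + lbr y (lbr x z)"
proof -
  have a: "lbr y (lbr z x) = - lbr y (lbr x z)"
    using assms anticomm[of z x] scale_right[of y "lbr x z" "-1"] closed[of x z] by simp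
  have b: "lbr z (lbr x y) = - lbr (lbr x y) z"
    using assms anticomm[of z "lbr x y"] closed by simp
  show ?thesis using jacobi[OF assms] a b by (simp add: algebra_simps eq_neg_iff_add_eq_0)
qed

lemma lbracket_subset_iff: "subspace V \<Longrightarrow> lbracket A B \<subseteq> V \<longleftrightarrow> (\<forall>a\<in>A. \<forall>b\<in>B. lbr a b \<in> V)"
  unfolding lbracket_def
  using span_minimal[of "{lbr a b | a b. a \<in> A \<and> b \<in> B}" V]
    span_superset[of "{lbr a b | a b. a \<in> A \<and> b \<in> B}"]
  by auto

lemma lbracket_eq_0_iff: "lbracket A B = {0} \<longleftrightarrow> (\<forall>a\<in>A. \<forall>b\<in>B. lbr a b = 0)"
proof -
  have "lbracket A B = {0} \<longleftrightarrow> lbracket A B \<subseteq> {0}"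
    unfolding lbracket_def using span_zero by blast
  then show ?thesis using lbracket_subset_iff[of "{0}" A B] by auto
qed

lemma subspace_into:
  assumes "x \<in> Q" "subspace V"
  shows "subspace {y \<in> Q. lbr x y \<in> V}"
  unfolding subspace_def
  using assms subspace_Q
  by (auto simp: zero_right add_right scale_right subspace_0 subspace_add subspace_scale)

lemma foldr_in: "set xs \<subseteq> Q \<Longrightarrow> q \<in> Q \<Longrightarrow> foldr lbr xs q \<in> Q"
  by (induction xs) (auto simp: closed)

lemma ad_generated_subset: "L \<subseteq> Q \<Longrightarrow> q \<in> Q \<Longrightarrow> ad_generated L q \<subseteq> Q"
  unfolding ad_generated_def using foldr_in subspace_Q by (intro span_minimal) blast+

lemma ad_generated_base: "q \<in> ad_generated L q"
  unfolding ad_generated_def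
  by (rule span_base, rule CollectI, rule exI[of _ "[]"]) simp

lemma ad_generated_closed:
  assumes "L \<subseteq> Q" "q \<in> Q" "x \<in> L" "r \<in> ad_generated L q"
  shows "lbr x r \<in> ad_generated L q"
proof -
  have "foldr lbr xs q \<in> {y \<in> Q. lbr x y \<in> ad_generated L q}" if "set xs \<subseteq> L" for xs
  proof -
    have "foldr lbr (x # xs) q \<in> ad_generated L q"
      unfolding ad_generated_def using that assms(3)
      by (intro span_base CollectI exI[of _ "x # xs"]) simp
    then show ?thesis using foldr_in[of xs q] that assms by auto
  qed
  moreover have "subspace {y \<in> Q. lbr x y \<in> ad_generated L q}"
    using assms by (intro subspace_into) (auto simp: ad_generated_def)
  ultimately have "ad_generated L q \<subseteq> {y \<in> Q. lbr x y \<in> ad_generated L q}"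
    unfolding ad_generated_def[of L q] by (intro span_minimal) blast+
  then show ?thesis using assms by blast
qed

text \<open>The definition of \<open>algebra_of_quotients\<close> and the characterization by ideals agree.\<close>

lemma algebra_of_quotients_iff:
  assumes L: "subalgebra L"
  shows "algebra_of_quotients scale Q lbr L \<longleftrightarrow>
    (\<forall>q\<in>Q. q \<noteq> 0 \<longrightarrow> (\<exists>I. lie_ideal_of I L \<and> centralizer L I = {0} \<and>
       lbracket I {q} \<noteq> {0} \<and> lbracket I {q} \<subseteq> L))"
    (is "?A \<longleftrightarrow> ?B")
proof
  have subL: "subspace L" and LQ: "L \<subseteq> Q" using L by (auto simp: subalgebra_def)
  have LL: "lbr a b \<in> L" if "a \<in> L" "b \<in> L" for a b
    using L that subL by (auto simp: subalgebra_def lbracket_subset_iff)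
  {
    assume ?A
    then interpret algebra_of_quotients scale Q lbr L .
    show ?B
    proof (intro ballI impI)
      fix q assume q: "q \<in> Q" "q \<noteq> 0"
      let ?G = "ad_generated L q"
      have GQ: "?G \<subseteq> Q" using ad_generated_subset LQ q by blast
      define I where "I = {x \<in> L. \<forall>g\<in>?G. lbr x g \<in> L}"
      have subI: "subspace I"
        using subL LQ GQ unfolding I_def subspace_def
        by (auto simp: zero_left add_left scale_left subset_iff)
      have "lbr x y \<in> I" if x: "x \<in> I" and y: "y \<in> L" for x y
      proof -
        have "lbr (lbr x y) g \<in> L" if g: "g \<in> ?G" for g
        proof -
          have xQ: "x \<in> Q" and yQ: "y \<in> Q" and gQ: "g \<in> Q" and xL: "x \<in> L"
            using x y g GQ LQ by (auto simp: I_def)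
          have "lbr (lbr x y) g = lbr x (lbr y g) - lbr y (lbr x g)"
            using jacobi'[OF xQ yQ gQ] by simp
          moreover have "lbr x (lbr y g) \<in> L"
            using x ad_generated_closed[OF LQ q(1) y g] by (auto simp: I_def)
          moreover have "lbr y (lbr x g) \<in> L" using x y g LL by (auto simp: I_def)
          ultimately show ?thesis using subL subspace_diff by simp
        qed
        then show ?thesis using x y LL by (auto simp: I_def)
      qed
      then have "lie_ideal_of I L"
        using subI by (auto simp: lie_ideal_of_def lbracket_subset_iff) (auto simp: I_def)
      moreover have "centralizer L I = {0}"
      proof -
        have "p = 0" if p: "p \<in> L" "\<forall>i\<in>I. lbr p i = 0" for p
        proof (rule ccontr)
          assume "p \<noteq> 0"
          then obtain x where x: "x \<in> L" "lbr x p \<noteq> 0" "lbracket {x} ?G \<subseteq> L"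
            using quotients[of p q] p LQ q by blast
          then have "x \<in> I" using subL by (auto simp: I_def lbracket_subset_iff)
          then show False using p x anticomm[of x p] LQ by auto
        qed
        moreover have "0 \<in> centralizer L I"
          using subL subspace_0 LQ by (auto simp: centralizer_def lbracket_eq_0_iff I_def zero_left subset_iff)
        ultimately show ?thesis by (auto simp: centralizer_def lbracket_eq_0_iff)
      qed
      moreover have "lbracket I {q} \<noteq> {0}"
      proof -
        obtain x where x: "x \<in> L" "lbr x q \<noteq> 0" "lbracket {x} ?G \<subseteq> L"
          using quotients[of q q] q by blast
        then have "x \<in> I" using subL by (auto simp: I_def lbracket_subset_iff)
        then show ?thesis using x by (auto simp: lbracket_eq_0_iff)
      qed
      moreover have "lbracket I {q} \<subseteq> L"
        using subL ad_generated_base by (auto simp: lbracket_subset_iff I_def)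
      ultimately show "\<exists>I. lie_ideal_of I L \<and> centralizer L I = {0} \<and>
         lbracket I {q} \<noteq> {0} \<and> lbracket I {q} \<subseteq> L" by blast
    qed
  next
    assume B: ?B
    show ?A
    proof unfold_locales
      show "subalgebra L" by (rule L)
      fix p q assume p: "p \<in> Q" and q: "q \<in> Q" and p0: "p \<noteq> 0"
      obtain I where I: "lie_ideal_of I L" "centralizer L I = {0}" "lbracket I {q} \<subseteq> L"
      proof (cases "q = 0")
        case True
        obtain I where I: "lie_ideal_of I L" "centralizer L I = {0}" using B p p0 by blast
        then have "lbracket I {q} \<subseteq> L"
          using True subL LQ subspace_0[OF subL]
          by (simp add: lbracket_subset_iff[OF subL]) (auto simp: zero_right lie_ideal_of_def)
        then show ?thesis using I that by blast
      next
        case False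
        then show ?thesis using B q that by blast
      qed
      have subI: "subspace I" and IL: "I \<subseteq> L" using I by (auto simp: lie_ideal_of_def)
      have II: "lbr i x \<in> I" if "i \<in> I" "x \<in> L" for i x
        using I that subI by (auto simp: lie_ideal_of_def lbracket_subset_iff)
      have fold: "\<forall>i\<in>I. lbr i (foldr lbr xs q) \<in> L" if "set xs \<subseteq> L" for xs
        using that
      proof (induction xs)
        case Nil
        then show ?case using I subL by (auto simp: lbracket_subset_iff)
      next
        case (Cons x xs)
        let ?r = "foldr lbr xs q"
        show ?case
        proof
          fix i assume i: "i \<in> I"
          have "i \<in> Q" "x \<in> Q" "?r \<in> Q" using i IL LQ Cons foldr_in[of xs q] q by auto
          then have "lbr i (lbr x ?r) = lbr (lbr i x) ?r + lbr x (lbr i ?r)" by (rule jacobi')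
          moreover have "lbr (lbr i x) ?r \<in> L" "lbr x (lbr i ?r) \<in> L"
            using Cons i II LL by auto
          ultimately show "lbr i (foldr lbr (x # xs) q) \<in> L" using subL subspace_add by simp
        qed
      qed
      have gen: "lbracket {i} (ad_generated L q) \<subseteq> L" if i: "i \<in> I" for i
      proof -
        have iQ: "i \<in> Q" using i IL LQ by auto
        have "ad_generated L q \<subseteq> {y \<in> Q. lbr i y \<in> L}"
          unfolding ad_generated_def
        proof (rule span_minimal)
          show "{foldr lbr xs q | xs. set xs \<subseteq> L} \<subseteq> {y \<in> Q. lbr i y \<in> L}"
            using fold i foldr_in LQ q by blast
        qed (rule subspace_into[OF iQ subL])
        then show ?thesis using subL by (auto simp: lbracket_subset_iff)
      qed
      have "\<exists>i\<in>I. lbr i p \<noteq> 0"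
      proof (rule ccontr)
        assume "\<not> ?thesis"
        then have ip: "lbr i p = 0" if "i \<in> I" for i using that by blast
        obtain J where J: "lie_ideal_of J L" "lbracket J {p} \<noteq> {0}" "lbracket J {p} \<subseteq> L"
          using B p p0 by blast
        then obtain j where j: "j \<in> J" "lbr j p \<noteq> 0" by (auto simp: lbracket_eq_0_iff)
        have jL: "j \<in> L" and jp: "lbr j p \<in> L"
          using J j subL by (auto simp: lie_ideal_of_def lbracket_subset_iff)
        have "lbr (lbr j p) i = 0" if i: "i \<in> I" for i
        proof -
          have iQ: "i \<in> Q" and jQ: "j \<in> Q" using i IL LQ jL by auto
          have "lbr i (lbr j p) = lbr (lbr i j) p + lbr j (lbr i p)"
            using iQ jQ p by (rule jacobi')
          also have "\<dots> = 0" using ip i II jL jQ by (simp add: zero_right)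
          finally show ?thesis using anticomm[of "lbr j p" i] iQ jQ p closed by simp
        qed
        then have "lbr j p \<in> centralizer L I"
          using jp by (auto simp: centralizer_def lbracket_eq_0_iff)
        then show False using I j by auto
      qed
      then show "\<exists>x\<in>L. lbr x p \<noteq> 0 \<and> lbracket {x} (ad_generated L q) \<subseteq> L"
        using gen IL by blast
    qed
  }
qed

end

definition lie_monomorphism ::
  "('f \<Rightarrow> 'b::ab_group_add \<Rightarrow> 'b) \<Rightarrow> 'b set \<Rightarrow> ('b \<Rightarrow> 'b \<Rightarrow> 'b) \<Rightarrow>
   ('f \<Rightarrow> 'c::ab_group_add \<Rightarrow> 'c) \<Rightarrow> 'c set \<Rightarrow> ('c \<Rightarrow> 'c \<Rightarrow> 'c) \<Rightarrow> ('b \<Rightarrow> 'c) \<Rightarrow> bool" where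
  "lie_monomorphism s1 L1 b1 s2 L2 b2 h \<longleftrightarrow>
     h ` L1 \<subseteq> L2 \<and> inj_on h L1 \<and>
     (\<forall>x\<in>L1. \<forall>y\<in>L1. h (x + y) = h x + h y) \<and>
     (\<forall>c. \<forall>x\<in>L1. h (s1 c x) = s2 c (h x)) \<and>
     (\<forall>x\<in>L1. \<forall>y\<in>L1. h (b1 x y) = b2 (h x) (h y))"


section \<open>The standard embedding\<close>

context lie_triple_system
begin

definition op_scale :: "'f \<Rightarrow> ('a \<Rightarrow> 'a) \<Rightarrow> ('a \<Rightarrow> 'a)" where
  "op_scale c f = (\<lambda>z. scale c (f z))"

definition emb_scale :: "'f \<Rightarrow> ('a \<Rightarrow> 'a) \<times> 'a \<Rightarrow> ('a \<Rightarrow> 'a) \<times> 'a" where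
  "emb_scale c p = (op_scale c (fst p), scale c (snd p))"

text \<open>
  Operators on \<open>T\<close> are represented by functions on \<open>'a\<close> that vanish outside \<open>T\<close>; thus two
  operators are equal iff they agree on \<open>T\<close>.
\<close>

definition lop :: "'a set \<Rightarrow> 'a \<Rightarrow> 'a \<Rightarrow> ('a \<Rightarrow> 'a)" where
  "lop T x y = (\<lambda>z. if z \<in> T then br x y z else 0)"

definition lops :: "'a set \<Rightarrow> ('a \<Rightarrow> 'a) set" where
  "lops T = module.span op_scale {lop T x y | x y. x \<in> T \<and> y \<in> T}"

definition std_embedding :: "'a set \<Rightarrow> (('a \<Rightarrow> 'a) \<times> 'a) set" where
  "std_embedding T = lops T \<times> T"

text \<open>
  The product is the bilinear map given on the spanning elements \<open>(lop T x y, z)\<close> by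
  \<open>[(lop T x y, z), (lop T u v, w)] =
     (lop T (br u v y) x - lop T (br u v x) y + lop T z w, br x y w - br u v z)\<close>,
  see \<open>emb_bracket_lop\<close>; bilinearity is part of \<open>lie_algebra_std_embedding\<close>. Since \<open>lops T\<close>
  consists of derivations of \<open>T\<close>, the first two operators are the commutator of \<open>lop T x y\<close>
  and \<open>lop T u v\<close>, which gives a definition independent of the choice of \<open>x, y, u, v\<close>.
\<close>

definition emb_bracket ::
  "'a set \<Rightarrow> ('a \<Rightarrow> 'a) \<times> 'a \<Rightarrow> ('a \<Rightarrow> 'a) \<times> 'a \<Rightarrow> ('a \<Rightarrow> 'a) \<times> 'a" where
  "emb_bracket T p q =
     ((fst p \<circ> fst q) - (fst q \<circ> fst p) + lop T (snd p) (snd q), fst p (snd q) - fst q (snd p))"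

lemmas lin1 = linear_1[THEN Vector_Spaces.linear.axioms(3)]
  and lin2 = linear_2[THEN Vector_Spaces.linear.axioms(3)]
  and lin3 = linear_3[THEN Vector_Spaces.linear.axioms(3)]

lemmas br_linear =
  lin1[THEN module_hom.add] lin2[THEN module_hom.add] lin3[THEN module_hom.add]
  lin1[THEN module_hom.scale] lin2[THEN module_hom.scale] lin3[THEN module_hom.scale]

lemmas br_more =
  lin1[THEN module_hom.zero] lin2[THEN module_hom.zero] lin3[THEN module_hom.zero]
  lin1[THEN module_hom.neg] lin2[THEN module_hom.neg] lin3[THEN module_hom.neg]
  lin1[THEN module_hom.diff] lin2[THEN module_hom.diff] lin3[THEN module_hom.diff]

lemma br_skew: "br y x z = - br x y z"
proof -
  have "br (x + y) (x + y) z = br x (x + y) z + br y (x + y) z"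
    by (simp only: lin1[THEN module_hom.add])
  also have "\<dots> = br x y z + br y x z"
    by (simp only: lin2[THEN module_hom.add] alternating add_0_left add_0_right)
  finally show ?thesis by (simp add: alternating eq_neg_iff_add_eq_0 add.commute)
qed

lemma subsystem_iff: "subsystem T \<longleftrightarrow> subspace T \<and> (\<forall>x\<in>T. \<forall>y\<in>T. \<forall>z\<in>T. br x y z \<in> T)"
  unfolding subsystem_def bracket_def
  using span_minimal[of "{br a b c | a b c. a \<in> T \<and> b \<in> T \<and> c \<in> T}" T]
    span_superset[of "{br a b c | a b c. a \<in> T \<and> b \<in> T \<and> c \<in> T}"]
  by blast

lemma subsystem_UNIV: "subsystem UNIV"
  by (simp add: subsystem_iff)

lemma vector_space_op_scale: "vector_space op_scale"
  by unfold_locales (auto simp: op_scale_def plus_fun_def algebra_simps)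

lemma vector_space_emb_scale: "vector_space emb_scale"
  by unfold_locales (auto simp: emb_scale_def op_scale_def plus_fun_def prod_eq_iff algebra_simps)

lemma module_op_scale: "module op_scale"
  using vector_space_op_scale by (simp add: module_iff_vector_space)

lemma module_emb_scale: "module emb_scale"
  using vector_space_emb_scale by (simp add: module_iff_vector_space)

lemma lops_induct [consumes 1, case_names zero add scale lop]:
  assumes "D \<in> lops T" "P 0"
    and "\<And>D E. P D \<Longrightarrow> P E \<Longrightarrow> P (D + E)"
    and "\<And>c D. P D \<Longrightarrow> P (op_scale c D)"
    and "\<And>a b. a \<in> T \<Longrightarrow> b \<in> T \<Longrightarrow> P (lop T a b)"
  shows "P D"
proof -
  have "module.subspace op_scale {D. P D}"
    using assms by (auto simp: module.subspace_def[OF module_op_scale])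
  then have "lops T \<subseteq> {D. P D}"
    unfolding lops_def using assms by (intro module.span_minimal[OF module_op_scale]) auto
  then show ?thesis using assms(1) by blast
qed

lemma lops_0: "0 \<in> lops T"
  and lops_add: "D \<in> lops T \<Longrightarrow> E \<in> lops T \<Longrightarrow> D + E \<in> lops T"
  and lops_diff: "D \<in> lops T \<Longrightarrow> E \<in> lops T \<Longrightarrow> D - E \<in> lops T"
  and lops_scale: "D \<in> lops T \<Longrightarrow> op_scale c D \<in> lops T"
  unfolding lops_def
  by (auto intro: module.span_zero[OF module_op_scale] module.span_add[OF module_op_scale]
      module.span_diff[OF module_op_scale] module.span_scale[OF module_op_scale])

lemma lop_in: "a \<in> T \<Longrightarrow> b \<in> T \<Longrightarrow> lop T a b \<in> lops T"
  unfolding lops_def by (rule module.span_base[OF module_op_scale]) blast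

context
  fixes T assumes T: "subsystem T"
begin

lemma subspT: "subspace T" and brT: "x \<in> T \<Longrightarrow> y \<in> T \<Longrightarrow> z \<in> T \<Longrightarrow> br x y z \<in> T"
  using T by (auto simp: subsystem_iff)

lemmas T_closed = subspace_0[OF subspT] subspace_add[OF subspT] subspace_diff[OF subspT]
  subspace_scale[OF subspT] subspace_neg[OF subspT] brT

lemma lops_outside: "D \<in> lops T \<Longrightarrow> z \<notin> T \<Longrightarrow> D z = 0"
  by (induction rule: lops_induct) (auto simp: op_scale_def lop_def)

lemma lops_in: "D \<in> lops T \<Longrightarrow> z \<in> T \<Longrightarrow> D z \<in> T"
  by (induction rule: lops_induct) (auto simp: op_scale_def lop_def T_closed)

lemma lops_plus: "D \<in> lops T \<Longrightarrow> y \<in> T \<Longrightarrow> z \<in> T \<Longrightarrow> D (y + z) = D y + D z"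
  by (induction rule: lops_induct)
    (auto simp: op_scale_def lop_def T_closed br_linear algebra_simps)

lemma lops_smult: "D \<in> lops T \<Longrightarrow> z \<in> T \<Longrightarrow> D (scale c z) = scale c (D z)"
  by (induction rule: lops_induct)
    (auto simp: op_scale_def lop_def T_closed br_linear algebra_simps scale_left_commute)

lemma lops_zero: "D \<in> lops T \<Longrightarrow> D 0 = 0"
  using lops_smult[of D 0 0] T_closed by simp

lemma lops_minus: "D \<in> lops T \<Longrightarrow> y \<in> T \<Longrightarrow> z \<in> T \<Longrightarrow> D (y - z) = D y - D z"
  using lops_plus[of D "y - z" z] T_closed by (simp add: algebra_simps)

lemma lops_derivation:
  "D \<in> lops T \<Longrightarrow> x \<in> T \<Longrightarrow> y \<in> T \<Longrightarrow> z \<in> T \<Longrightarrow>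
   D (br x y z) = br (D x) y z + br x (D y) z + br x y (D z)"
proof (induction rule: lops_induct)
  case (lop a b)
  then show ?case using derivation[of a b x y z] by (simp add: lop_def T_closed)
qed (auto simp: op_scale_def br_linear br_more algebra_simps)

lemma comm_lop:
  assumes "D \<in> lops T" "a \<in> T" "b \<in> T"
  shows "(D \<circ> lop T a b) - (lop T a b \<circ> D) = lop T (D a) b + lop T a (D b)"
  using assms
  by (auto simp: fun_eq_iff lop_def lops_derivation lops_in lops_outside lops_zero T_closed
      br_more algebra_simps)

lemma comm_in:
  assumes "D \<in> lops T" "E \<in> lops T"
  shows "(D \<circ> E) - (E \<circ> D) \<in> lops T"
  using assms(2)
proof -
  have "(D \<circ> E) - (E \<circ> D) \<in> lops T \<and> E \<in> lops T"
    using assms(2)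
  proof (induction rule: lops_induct)
    case zero
    have "(D \<circ> 0) - (0 \<circ> D) = 0" using assms by (auto simp: fun_eq_iff lops_zero)
    then show ?case by (simp only: lops_0 simp_thms)
  next
    case (add E F)
    have "(D \<circ> (E + F)) - ((E + F) \<circ> D) = ((D \<circ> E) - (E \<circ> D)) + ((D \<circ> F) - (F \<circ> D))"
    proof
      fix z show "((D \<circ> (E + F)) - ((E + F) \<circ> D)) z = (((D \<circ> E) - (E \<circ> D)) + ((D \<circ> F) - (F \<circ> D))) z"
        using assms(1) add
        by (cases "z \<in> T") (auto simp: lops_plus lops_in lops_outside lops_zero)
    qed
    then show ?case using add by (simp only: lops_add simp_thms)
  next
    case (scale c E)
    have "(D \<circ> op_scale c E) - (op_scale c E \<circ> D) = op_scale c ((D \<circ> E) - (E \<circ> D))"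
    proof
      fix z show "((D \<circ> op_scale c E) - (op_scale c E \<circ> D)) z = op_scale c ((D \<circ> E) - (E \<circ> D)) z"
        using assms(1) scale
        by (cases "z \<in> T")
          (auto simp: op_scale_def lops_smult lops_in lops_outside lops_zero algebra_simps)
    qed
    then show ?case using scale by (simp only: lops_scale simp_thms)
  next
    case (lop a b)
    then show ?case using assms by (simp only: comm_lop lops_add lop_in lops_in simp_thms)
  qed
  then show ?thesis ..
qed

lemma emb_bracket_lop:
  assumes "x \<in> T" "y \<in> T" "z \<in> T" "u \<in> T" "v \<in> T" "w \<in> T"
  shows "emb_bracket T (lop T x y, z) (lop T u v, w) =
     (lop T (br u v y) x - lop T (br u v x) y + lop T z w, br x y w - br u v z)"
proof -
  have "(lop T u v \<circ> lop T x y) - (lop T x y \<circ> lop T u v) =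
      lop T (br u v x) y + lop T x (br u v y)"
    using comm_lop[OF lop_in[OF assms(4,5)] assms(1,2)] assms by (simp add: lop_def)
  moreover have "lop T x (br u v y) = - lop T (br u v y) x"
    by (auto simp: lop_def br_skew[of x])
  ultimately have "(lop T x y \<circ> lop T u v) - (lop T u v \<circ> lop T x y) =
      lop T (br u v y) x - lop T (br u v x) y"
    by (simp add: algebra_simps)
  then show ?thesis using assms by (simp add: emb_bracket_def) (simp add: lop_def)
qed

lemma lie_algebra_std_embedding: "lie_algebra emb_scale (std_embedding T) (emb_bracket T)"
proof -
  interpret E: vector_space emb_scale by (rule vector_space_emb_scale)
  show ?thesis
  proof
    show "E.subspace (std_embedding T)"
      by (auto simp: E.subspace_def std_embedding_def emb_scale_def zero_prod_def plus_prod_def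
          lops_0 lops_add lops_scale T_closed)
  next
    fix x y assume "x \<in> std_embedding T" "y \<in> std_embedding T"
    then obtain D a E b where
      eqs: "x = (D, a)" "y = (E, b)" and
      mem: "D \<in> lops T" "a \<in> T" "E \<in> lops T" "b \<in> T"
      by (auto simp: std_embedding_def)
    have "(D \<circ> E) - (E \<circ> D) + lop T a b \<in> lops T"
      using mem by (intro lops_add comm_in lop_in)
    moreover have "D b - E a \<in> T"
      using mem by (simp add: T_closed(3) lops_in)
    ultimately show "emb_bracket T x y \<in> std_embedding T"
      by (simp add: eqs std_embedding_def emb_bracket_def)
  next
    fix x y z assume "x \<in> std_embedding T" "y \<in> std_embedding T" "z \<in> std_embedding T"
    then obtain D a E b F c where
      eqs: "x = (D, a)" "y = (E, b)" "z = (F, c)" and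
      mem: "D \<in> lops T" "a \<in> T" "E \<in> lops T" "b \<in> T" "F \<in> lops T" "c \<in> T"
      by (auto simp: std_embedding_def)
    show "emb_bracket T (x + y) z = emb_bracket T x z + emb_bracket T y z"
    proof (intro prod_eqI ext)
      fix w show "fst (emb_bracket T (x + y) z) w = fst (emb_bracket T x z + emb_bracket T y z) w"
        using mem
        by (cases "w \<in> T") (simp_all add: eqs emb_bracket_def emb_scale_def op_scale_def
            lop_def br_linear lops_plus lops_smult lops_in lops_outside lops_zero algebra_simps)
    next
      show "snd (emb_bracket T (x + y) z) = snd (emb_bracket T x z + emb_bracket T y z)"
        using mem by (simp add: eqs emb_bracket_def emb_scale_def op_scale_def
            lops_plus lops_smult algebra_simps)
    qed
  next
    fix x y z assume "x \<in> std_embedding T" "y \<in> std_embedding T" "z \<in> std_embedding T"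
    then obtain D a E b F c where
      eqs: "x = (D, a)" "y = (E, b)" "z = (F, c)" and
      mem: "D \<in> lops T" "a \<in> T" "E \<in> lops T" "b \<in> T" "F \<in> lops T" "c \<in> T"
      by (auto simp: std_embedding_def)
    show "emb_bracket T x (y + z) = emb_bracket T x y + emb_bracket T x z"
    proof (intro prod_eqI ext)
      fix w show "fst (emb_bracket T x (y + z)) w = fst (emb_bracket T x y + emb_bracket T x z) w"
        using mem
        by (cases "w \<in> T") (simp_all add: eqs emb_bracket_def emb_scale_def op_scale_def
            lop_def br_linear lops_plus lops_smult lops_in lops_outside lops_zero algebra_simps)
    next
      show "snd (emb_bracket T x (y + z)) = snd (emb_bracket T x y + emb_bracket T x z)"
        using mem by (simp add: eqs emb_bracket_def emb_scale_def op_scale_def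
            lops_plus lops_smult algebra_simps)
    qed
  next
    fix k x y assume "x \<in> std_embedding T" "y \<in> std_embedding T"
    then obtain D a E b where
      eqs: "x = (D, a)" "y = (E, b)" and
      mem: "D \<in> lops T" "a \<in> T" "E \<in> lops T" "b \<in> T"
      by (auto simp: std_embedding_def)
    show "emb_bracket T (emb_scale k x) y = emb_scale k (emb_bracket T x y)"
    proof (intro prod_eqI ext)
      fix w show "fst (emb_bracket T (emb_scale k x) y) w = fst (emb_scale k (emb_bracket T x y)) w"
        using mem
        by (cases "w \<in> T") (simp_all add: eqs emb_bracket_def emb_scale_def op_scale_def
            lop_def br_linear lops_plus lops_smult lops_in lops_outside lops_zero algebra_simps)
    next
      show "snd (emb_bracket T (emb_scale k x) y) = snd (emb_scale k (emb_bracket T x y))"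
        using mem by (simp add: eqs emb_bracket_def emb_scale_def op_scale_def
            lops_plus lops_smult algebra_simps)
    qed
  next
    fix k x y assume "x \<in> std_embedding T" "y \<in> std_embedding T"
    then obtain D a E b where
      eqs: "x = (D, a)" "y = (E, b)" and
      mem: "D \<in> lops T" "a \<in> T" "E \<in> lops T" "b \<in> T"
      by (auto simp: std_embedding_def)
    show "emb_bracket T x (emb_scale k y) = emb_scale k (emb_bracket T x y)"
    proof (intro prod_eqI ext)
      fix w show "fst (emb_bracket T x (emb_scale k y)) w = fst (emb_scale k (emb_bracket T x y)) w"
        using mem
        by (cases "w \<in> T") (simp_all add: eqs emb_bracket_def emb_scale_def op_scale_def
            lop_def br_linear lops_plus lops_smult lops_in lops_outside lops_zero algebra_simps)
    next
      show "snd (emb_bracket T x (emb_scale k y)) = snd (emb_scale k (emb_bracket T x y))"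
        using mem by (simp add: eqs emb_bracket_def emb_scale_def op_scale_def
            lops_plus lops_smult algebra_simps)
    qed
  next
    fix x assume "x \<in> std_embedding T"
    show "emb_bracket T x x = 0"
      by (auto simp: emb_bracket_def zero_prod_def fun_eq_iff lop_def alternating)
  next
    fix x y z assume "x \<in> std_embedding T" "y \<in> std_embedding T" "z \<in> std_embedding T"
    then obtain D a E b F c where
      xyz: "x = (D, a)" "y = (E, b)" "z = (F, c)" and
      ops: "D \<in> lops T" "E \<in> lops T" "F \<in> lops T" and el: "a \<in> T" "b \<in> T" "c \<in> T"
      by (auto simp: std_embedding_def)
    have op: "((D \<circ> ((E \<circ> F) - (F \<circ> E) + lop T b c)) - (((E \<circ> F) - (F \<circ> E) + lop T b c) \<circ> D)
          + lop T a (E c - F b))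
        + ((E \<circ> ((F \<circ> D) - (D \<circ> F) + lop T c a)) - (((F \<circ> D) - (D \<circ> F) + lop T c a) \<circ> E)
          + lop T b (F a - D c))
        + ((F \<circ> ((D \<circ> E) - (E \<circ> D) + lop T a b)) - (((D \<circ> E) - (E \<circ> D) + lop T a b) \<circ> F)
          + lop T c (D b - E a)) = 0"
    proof
      fix w
      show "(((D \<circ> ((E \<circ> F) - (F \<circ> E) + lop T b c)) - (((E \<circ> F) - (F \<circ> E) + lop T b c) \<circ> D)
          + lop T a (E c - F b))
        + ((E \<circ> ((F \<circ> D) - (D \<circ> F) + lop T c a)) - (((F \<circ> D) - (D \<circ> F) + lop T c a) \<circ> E)
          + lop T b (F a - D c))
        + ((F \<circ> ((D \<circ> E) - (E \<circ> D) + lop T a b)) - (((D \<circ> E) - (E \<circ> D) + lop T a b) \<circ> F)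
          + lop T c (D b - E a))) w = 0 w"
      proof (cases "w \<in> T")
        case True
        then show ?thesis
          using ops el br_skew[of a "E c" w] br_skew[of a "F b" w] br_skew[of b "F a" w]
            br_skew[of b "D c" w] br_skew[of c "D b" w] br_skew[of c "E a" w]
          by (simp add: lop_def lops_plus lops_minus lops_in lops_derivation T_closed br_more)
      next
        case False
        then show ?thesis using ops by (simp add: lop_def lops_outside lops_zero br_more)
      qed
    qed
    have el_eq: "(D (E c - F b) - (E (F a) - F (E a) + br b c a))
        + (E (F a - D c) - (F (D b) - D (F b) + br c a b))
        + (F (D b - E a) - (D (E c) - E (D c) + br a b c)) = 0"
      using ops el cyclic[of a b c] by (simp add: lops_minus lops_in algebra_simps)
    show "emb_bracket T x (emb_bracket T y z) + emb_bracket T y (emb_bracket T z x) +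
       emb_bracket T z (emb_bracket T x y) = 0"
      using op el_eq el unfolding xyz emb_bracket_def by (simp add: zero_prod_def lop_def)
  qed
qed

end

text \<open>
  The map \<open>x + \<Sum>\<^sub>i lop T a\<^sub>i b\<^sub>i \<mapsto> x + \<Sum>\<^sub>i lop UNIV a\<^sub>i b\<^sub>i\<close>. A \<open>\<iota>\<close> with this property exists only
  if the map is well defined, and is then unique on \<open>std_embedding T\<close>.
\<close>

definition canonical_map :: "'a set \<Rightarrow> (('a \<Rightarrow> 'a) \<times> 'a \<Rightarrow> ('a \<Rightarrow> 'a) \<times> 'a) \<Rightarrow> bool" where
  "canonical_map T \<iota> \<longleftrightarrow> (\<forall>x\<in>T. \<forall>ps. set ps \<subseteq> T \<times> T \<longrightarrow>
     \<iota> (\<Sum>(a, b)\<leftarrow>ps. lop T a b, x) = (\<Sum>(a, b)\<leftarrow>ps. lop UNIV a b, x))"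

end

end

theory Submission
  imports Defs
begin

text \<open>
  Since \<open>T\<close> is semiprime, the products \<open>[T, I, I]\<close> and the finite intersections of essential ideals
  are essential, and \<open>(T : s)\<close> is essential for every \<open>s\<close>. For \<open>q \<in> L(S)\<close>, iterating such products
  on an intersection of ideals \<open>(T : s)\<close> gives an essential ideal \<open>I\<close> of \<open>T\<close> with
  \<open>[I + [I, T], q] \<subseteq> L(T)\<close>, and no nonzero element of \<open>L(S)\<close> is annihilated by \<open>I + [I, T]\<close>.

  For the second claim call \<open>q \<in> L(S)\<close> a sandwich if \<open>[q, [q, z]] = 0\<close> for all \<open>z\<close>. The trilinear map
  \<open>(x, y, z) \<mapsto> [q, [x, [y, [q, z]]]]\<close> of a sandwich \<open>q\<close> is totally symmetric, its cubes are again
  sandwiches, and once enough cubes vanish its values at \<open>(y, y, t)\<close> are sandwiches, too. For \<open>q\<close> of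
  degree \<open>0\<close> and \<open>y\<close> in a suitable essential ideal these values lie in \<open>T\<close>, where nondegeneracy makes
  them vanish; this forces \<open>q = 0\<close>. If \<open>[S, s, s] = 0\<close>, then every \<open>[s, D s, -]\<close> with \<open>D \<in> L(S, S)\<close> is a
  sandwich of degree \<open>0\<close>, hence zero, so \<open>s\<close> itself is a sandwich, and the same method gives \<open>s = 0\<close>.
\<close>


section \<open>Sandwich elements of Lie algebras\<close>

context lie_algebra
begin

section \<open>Bracket calculus in a Lie algebra, in preparation for sandwich elements\<close>

lemma Q_closed:
  shows "0 \<in> Q" "x \<in> Q \<Longrightarrow> y \<in> Q \<Longrightarrow> x + y \<in> Q" "x \<in> Q \<Longrightarrow> y \<in> Q \<Longrightarrow> x - y \<in> Q"
    "x \<in> Q \<Longrightarrow> - x \<in> Q" "x \<in> Q \<Longrightarrow> y \<in> Q \<Longrightarrow> lbr x y \<in> Q"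
  using subspace_Q closed
  by (auto simp: subspace_0 subspace_add subspace_diff subspace_neg)

lemma lbr_minus:
  assumes "x \<in> Q" "y \<in> Q"
  shows "lbr (- x) y = - lbr x y" "lbr x (- y) = - lbr x y"
  using assms scale_left[of x y "-1"] scale_right[of x y "-1"] by simp_all

lemma lbr_diff:
  assumes "x \<in> Q" "y \<in> Q" "z \<in> Q"
  shows "lbr (x - y) z = lbr x z - lbr y z" "lbr x (y - z) = lbr x y - lbr x z"
  using assms add_left[of x "- y" z] add_right[of x y "- z"] by (simp_all add: lbr_minus Q_closed)

lemma lbr_lbr:
  assumes "x \<in> Q" "y \<in> Q" "z \<in> Q"
  shows "lbr (lbr x y) z = lbr x (lbr y z) - lbr y (lbr x z)"
  using jacobi'[OF assms] by (simp add: algebra_simps)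

lemmas expand = lbr_lbr lbr_diff lbr_minus add_left add_right Q_closed zero_left zero_right

text \<open>The value is \<open>[q, p]\<close> with \<open>p = [x, [y, [q, z]]]\<close>, so a
  product can be fed back as an argument of another; \<open>sym5\<close> is this iterate.\<close>

definition sym3 :: "'b \<Rightarrow> 'b \<Rightarrow> 'b \<Rightarrow> 'b \<Rightarrow> 'b" where
  "sym3 q x y z = lbr q (lbr x (lbr y (lbr q z)))"

definition sym5 :: "'b \<Rightarrow> 'b \<Rightarrow> 'b \<Rightarrow> 'b \<Rightarrow> 'b \<Rightarrow> 'b \<Rightarrow> 'b" where
  "sym5 q v w x y z = lbr q (lbr v (lbr w (sym3 q x y z)))"

context
  fixes q
  \<comment> \<open>The hypothesis on the characteristic enters as cancellation of 2 and 3 in the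
    additive group.\<close>
  assumes two: "\<And>z::'b. z + z = 0 \<Longrightarrow> z = 0" and three: "\<And>z::'b. z + z + z = 0 \<Longrightarrow> z = 0"
    and q: "q \<in> Q" and sq: "\<And>z. z \<in> Q \<Longrightarrow> lbr q (lbr q z) = 0"
begin

text \<open>Since [q, [q, y]] = 0, expanding its bracket with x leaves -2 [q, [y, [q, x]]] =
  0.\<close>

lemma sandwich_absorb:
  assumes "x \<in> Q" "y \<in> Q"
  shows "lbr q (lbr y (lbr q x)) = 0"
proof (rule two)
  have "- lbr q (lbr y (lbr q x)) = lbr q (lbr y (lbr q x))"
    using lbr_lbr[of q "lbr q y" x] assms q by (simp add: expand sq)
  then show "lbr q (lbr y (lbr q x)) + lbr q (lbr y (lbr q x)) = 0"
    by (simp only: neg_eq_iff_add_eq_0)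
qed

text \<open>Both symmetries are cases of \<open>sandwich_absorb\<close>: once with [x, y] between
  two copies of q, once with [q, [x, [q, [y, z]]]] and [q, [y, z]] expanded.\<close>

lemma sym3_commute:
  assumes "x \<in> Q" "y \<in> Q" "z \<in> Q"
  shows "sym3 q x y z = sym3 q y x z" "sym3 q x y z = sym3 q x z y"
proof -
  have "lbr q (lbr (lbr x y) (lbr q z)) = 0" using assms by (intro sandwich_absorb) (auto simp: Q_closed)
  then show "sym3 q x y z = sym3 q y x z" using assms q by (simp add: sym3_def expand)
  have "lbr q (lbr x (lbr q (lbr y z))) = 0" using assms by (intro sandwich_absorb) (auto simp: Q_closed)
  moreover have "lbr q (lbr y z) = lbr y (lbr q z) - lbr z (lbr q y)"
    using assms q jacobi'[of q y z] anticomm[of "lbr q y" z] by (simp add: Q_closed)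
  ultimately show "sym3 q x y z = sym3 q x z y" using assms q by (simp add: sym3_def expand)
qed

lemma sym5_eq_sym3:
  "sym5 q v w x y z = sym3 q v w (lbr x (lbr y (lbr q z)))"
  by (simp add: sym5_def sym3_def)

text \<open>
  Modulo the kernel of \<open>ad q\<close> both \<open>sym5\<close> and \<open>sym3\<close> are values of one symmetric trilinear product,
  \<open>sym5 q v w x y z\<close> being the product of \<open>v\<close>, \<open>w\<close> and the product of \<open>x\<close>, \<open>y\<close>, \<open>z\<close>.
\<close>

lemma sym5_commute:
  assumes "v \<in> Q" "w \<in> Q" "x \<in> Q" "y \<in> Q" "z \<in> Q"
  shows "sym5 q v w x y z = sym5 q w v x y z" "sym5 q v w x y z = sym5 q v w y x z"
    "sym5 q v w x y z = sym5 q v w x z y"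
  using assms q sym3_commute(1)[of v w "lbr x (lbr y (lbr q z))"] sym3_commute[of x y z]
  by (simp_all add: sym5_eq_sym3 Q_closed) (simp_all add: sym5_eq_sym3[symmetric] sym5_def)

lemma sym5_rotate:
  assumes "v \<in> Q" "w \<in> Q" "x \<in> Q" "y \<in> Q" "z \<in> Q"
  shows "sym5 q v w x y z = sym5 q v w z x y"
  by (rule trans[OF sym5_commute(3)[OF assms] sym5_commute(2)]) (use assms in auto)

text \<open>Symmetry moves the inner product \<open>p = [x, [y, [q, z]]]\<close> to the first slot.
  There ad p expands into eight words in ad x, ad y, ad q, ad z. All but three give two copies of ad
  q that are adjacent or one operator apart, and vanish.\<close>

lemma sym5_exchange:
  assumes "v \<in> Q" "w \<in> Q" "x \<in> Q" "y \<in> Q" "z \<in> Q"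
  shows "sym5 q v w x y z = sym5 q x y z v w + sym5 q x z y v w + sym5 q y z x v w"
proof -
  let ?p = "lbr x (lbr y (lbr q z))"
  have p: "?p \<in> Q" using assms q by (simp add: Q_closed)
  have "sym5 q v w x y z = sym3 q v w ?p" by (rule sym5_eq_sym3)
  also have "\<dots> = sym3 q ?p v w" using p assms sym3_commute by metis
  also have "\<dots> = lbr q (lbr x (lbr y (lbr q (lbr z (lbr v (lbr q w))))))
    + lbr q (lbr x (lbr z (lbr q (lbr y (lbr v (lbr q w))))))
    + lbr q (lbr y (lbr z (lbr q (lbr x (lbr v (lbr q w))))))"
    unfolding sym3_def using assms q by (simp add: expand sq sandwich_absorb)
  finally show ?thesis by (simp add: sym5_def sym3_def)
qed

text \<open>In the square of ad q ad p - ad p ad q only the word ad q ad p ad p ad q survives. So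
  [q, p] is a sandwich as soon as \<open>sym3 q p p\<close> vanishes.\<close>

lemma ad_square:
  assumes "p \<in> Q" "z \<in> Q"
  shows "lbr (lbr q p) (lbr (lbr q p) z) = - sym3 q p p z"
  unfolding sym3_def using assms q by (simp add: expand sq sandwich_absorb)

text \<open>The product of z, p, p involves p only through [q, p] in its last slot. If that is a
  product of a, b, c, the result is a \<open>sym5\<close> and can be exchanged.\<close>

lemma sym3_square:
  assumes "a \<in> Q" "b \<in> Q" "c \<in> Q" "p \<in> Q" "z \<in> Q" and p: "lbr q p = sym3 q a b c"
  shows "sym3 q p p z = sym5 q a b c z p + sym5 q a c b z p + sym5 q b c a z p"
proof -
  have "sym3 q p p z = sym3 q z p p"
    by (rule trans[OF sym3_commute(2) sym3_commute(1)]) (use assms in auto)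
  also have "\<dots> = sym5 q z p a b c" by (simp add: sym3_def[of q z] p sym5_def)
  also have "\<dots> = sym5 q a b c z p + sym5 q a c b z p + sym5 q b c a z p"
    using assms(5,4,1,2,3) by (rule sym5_exchange)
  finally show ?thesis .
qed

text \<open>In the exchange identity for y, y, y, y, u the first summand equals the left side, so
  the other two, which coincide, give 0: the product of y, u and the cube of y vanishes. The terms
  of \<open>sym3_square\<close> all contain such a product.\<close>

lemma cube_sandwich:
  assumes y: "y \<in> Q" and z: "z \<in> Q"
  shows "lbr (sym3 q y y y) (lbr (sym3 q y y y) z) = 0"
proof -
  define p where "p = lbr y (lbr y (lbr q y))"
  have p: "p \<in> Q" "lbr q p = sym3 q y y y" using y q by (simp_all add: p_def sym3_def Q_closed)
  have "sym5 q y u y y y + sym5 q y u y y y = 0" if "u \<in> Q" for u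
    using sym5_exchange[OF y y y y that] sym5_rotate[OF y y y y that, symmetric] by simp
  then have 0: "sym5 q y u y y y = 0" if "u \<in> Q" for u using that two by blast
  have "sym3 q y z p = 0" using 0[OF z] p by (simp add: sym3_def[of q y z] sym5_def)
  then have "sym5 q y y y z p = 0" using y q by (simp add: sym5_def zero_right)
  then have "sym3 q p p z = 0" using sym3_square[OF y y y p(1) z p(2)] by simp
  then show ?thesis using ad_square[OF p(1) z] p(2) by simp
qed

text \<open>Exchanging t, z against a vanishing cube gives three equal terms, hence the first claim.
  For the second, let A and B be the values with t and z swapped: the exchange identity yields A = 2
  B and B = 2 A, so 3 B = 0.\<close>

lemma sym5_cube_0:
  assumes "n \<in> Q" "t \<in> Q" "z \<in> Q" and cube: "sym3 q n n n = 0"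
  shows "sym5 q n n n t z = 0" "sym5 q n z n n t = 0"
proof -
  note mem = assms(1-3)
  have "sym5 q t z n n n = 0" using mem q cube by (simp add: sym5_def zero_right)
  then have "sym5 q n n n t z + sym5 q n n n t z + sym5 q n n n t z = 0"
    using sym5_exchange[OF mem(2,3) mem(1) mem(1) mem(1)] by simp
  then show a: "sym5 q n n n t z = 0" by (rule three)
  have b: "sym5 q n t n n z = sym5 q n z n n t + sym5 q n z n n t" if "t \<in> Q" "z \<in> Q" "sym5 q n n n t z = 0" for t z
  proof -
    have "sym5 q n n z n t = sym5 q n n n t z"
      using sym5_rotate[OF mem(1) mem(1) mem(1) that(1,2)] by simp
    then show ?thesis using sym5_exchange[OF mem(1) that(1) mem(1) mem(1) that(2)] that(3)
      by simp
  qed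
  have "sym5 q n n n z t = 0"
    using a sym5_commute(3)[OF mem(1) mem(1) mem(1) mem(3) mem(2)] by simp
  then have "sym5 q n z n n t = sym5 q n t n n z + sym5 q n t n n z"
    by (rule b[OF mem(3,2)])
  then have "sym5 q n z n n t + sym5 q n z n n t + sym5 q n z n n t = 0"
    using b[OF mem(2,3) a] by simp
  then show "sym5 q n z n n t = 0" by (rule three)
qed

text \<open>The vanishing cubes of y, p, y + p and y - p are linearised until each term of
  \<open>sym3_square\<close> for \<open>[q, p]\<close> is zero.\<close>

lemma square_sandwich:
  assumes y: "y \<in> Q" and t: "t \<in> Q" and p: "p \<in> Q" and z: "z \<in> Q"
    and qp: "lbr q p = sym3 q y y t"
    and cube: "sym3 q y y y = 0" "sym3 q p p p = 0"
      "sym3 q (y + p) (y + p) (y + p) = 0" "sym3 q (y - p) (y - p) (y - p) = 0"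
  shows "lbr (lbr q p) (lbr (lbr q p) z) = 0"
proof -
  have yp: "sym3 q y u p = 0" if u: "u \<in> Q" for u
    using sym5_cube_0(2)[OF y t u cube(1)] by (simp add: sym3_def[of q y u] qp sym5_def)
  have 1: "sym5 q y t y z p = 0" using y t q yp[OF z] by (simp add: sym5_def zero_right)
  \<comment> \<open>Subtracting keeps the words with an odd number of entries p, each twice.\<close>
  have "sym5 q (y + p) (y + p) (y + p) t z - sym5 q (y - p) (y - p) (y - p) t z =
      (sym5 q y y p t z + sym5 q y p y t z + sym5 q p y y t z + sym5 q p p p t z)
      + (sym5 q y y p t z + sym5 q y p y t z + sym5 q p y y t z + sym5 q p p p t z)"
    unfolding sym5_def sym3_def using y p t z q by (simp add: expand algebra_simps)
  then have "(sym5 q y y p t z + sym5 q y p y t z + sym5 q p y y t z + sym5 q p p p t z)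
      + (sym5 q y y p t z + sym5 q y p y t z + sym5 q p y y t z + sym5 q p p p t z) = 0"
    using sym5_cube_0(1)[OF _ t z cube(3)] sym5_cube_0(1)[OF _ t z cube(4)] y p
    by (simp add: Q_closed)
  then have "sym5 q y y p t z + sym5 q y p y t z + sym5 q p y y t z + sym5 q p p p t z = 0"
    by (rule two)
  moreover have "sym5 q p p p t z = 0" using sym5_cube_0(1)[OF p t z cube(2)] .
  moreover have "sym5 q y p y t z = 0"
  proof -
    let ?m = "lbr y (lbr t (lbr q z))"
    have m: "?m \<in> Q" using y t z q by (simp add: Q_closed)
    then show ?thesis using yp[OF m] y p sym3_commute(2)[of y p ?m] by (simp add: sym5_eq_sym3)
  qed
  moreover have "sym5 q p y y t z = sym5 q y p y t z" using sym5_commute(1)[OF p y y t z] .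
  ultimately have "sym5 q y y p t z = 0" by simp
  then have "sym5 q y y t z p = 0" using sym5_rotate[OF y y t z p] by simp
  then have "sym3 q p p z = 0"
    using sym3_square[OF y y t p z qp] 1 by simp
  then show ?thesis using ad_square[OF p z] by simp
qed

end

end

section \<open>Essential ideals\<close>

context lie_triple_system
begin

section \<open>Brackets, ideals and the ideals (T : s)\<close>

lemma br_cyclic: "br x y z = - br y z x - br z x y"
  using cyclic[of x y z] by (simp add: algebra_simps eq_neg_iff_add_eq_0)

lemma bracket_subset_iff:
  "subspace V \<Longrightarrow> bracket A B C \<subseteq> V \<longleftrightarrow> (\<forall>a\<in>A. \<forall>b\<in>B. \<forall>c\<in>C. br a b c \<in> V)"
  unfolding bracket_def
  using span_minimal[of "{br a b c | a b c. a \<in> A \<and> b \<in> B \<and> c \<in> C}" V]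
    span_superset[of "{br a b c | a b c. a \<in> A \<and> b \<in> B \<and> c \<in> C}"]
  by blast

lemma bracket_eq_0_iff: "bracket A B C = {0} \<longleftrightarrow> (\<forall>a\<in>A. \<forall>b\<in>B. \<forall>c\<in>C. br a b c = 0)"
proof -
  have "bracket A B C = {0} \<longleftrightarrow> bracket A B C \<subseteq> {0}"
    unfolding bracket_def using span_zero by blast
  then show ?thesis using bracket_subset_iff[of "{0}" A B C] by auto
qed

lemma br_in_bracket: "a \<in> A \<Longrightarrow> b \<in> B \<Longrightarrow> c \<in> C \<Longrightarrow> br a b c \<in> bracket A B C"
  unfolding bracket_def by (rule span_base) blast

lemma subspace_bracket: "subspace (bracket A B C)"
  by (simp add: bracket_def)

lemma generated_base: "s \<in> generated T s"
  unfolding generated_def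
  by (rule span_base, rule CollectI, rule exI[of _ "[]"]) simp

lemma generated_closed:
  assumes "x \<in> T" "y \<in> T" "m \<in> generated T s"
  shows "br m x y \<in> generated T s"
proof -
  have "subspace {m. br m x y \<in> generated T s}"
    by (auto simp: subspace_def br_linear br_more generated_def span_zero span_add span_scale)
  moreover have "foldr (\<lambda>(x, y). rmult x y) ps s \<in> {m. br m x y \<in> generated T s}"
    if "set ps \<subseteq> T \<times> T" for ps
  proof -
    have "foldr (\<lambda>(x, y). rmult x y) ((x, y) # ps) s \<in> generated T s"
      unfolding generated_def using that assms(1,2)
      by (intro span_base CollectI exI[of _ "(x, y) # ps"]) simp
    then show ?thesis by (simp add: rmult_def)
  qed
  ultimately have "generated T s \<subseteq> {m. br m x y \<in> generated T s}"
    unfolding generated_def[of T s] by (intro span_minimal) blast+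
  then show ?thesis using assms(3) by blast
qed

lemma generated_closed':
  assumes "x \<in> T" "y \<in> T" "m \<in> generated T s"
  shows "br x m y \<in> generated T s" "br x y m \<in> generated T s"
proof -
  have sub: "subspace (generated T s)" by (simp add: generated_def)
  show 1: "br x m y \<in> generated T s"
    using generated_closed[OF assms] br_skew[of x m y] subspace_neg[OF sub] by fastforce
  have "br x y m = br m y x - br m x y"
    using br_cyclic[of x y m] br_skew[of y m x] by simp
  then show "br x y m \<in> generated T s"
    using generated_closed assms subspace_diff[OF sub] by simp
qed

lemma ideal_of_iff:
  "ideal_of I T \<longleftrightarrow> subspace I \<and> I \<subseteq> T \<and> (\<forall>x\<in>I. \<forall>y\<in>T. \<forall>z\<in>T. br x y z \<in> I)"
  unfolding ideal_of_def using bracket_subset_iff[of I I T T] by blast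

lemma ideal_br:
  assumes "ideal_of I T" "i \<in> I" "t \<in> T" "u \<in> T"
  shows "br i t u \<in> I" "br t i u \<in> I" "br t u i \<in> I"
proof -
  have I: "subspace I" using assms by (simp add: ideal_of_iff)
  show 1: "br i t u \<in> I" using assms by (simp add: ideal_of_iff)
  show "br t i u \<in> I" using 1 br_skew[of t i u] subspace_neg[OF I] by simp
  have "br t u i = br i u t - br i t u"
    using br_cyclic[of t u i] br_skew[of u i t] by simp
  then show "br t u i \<in> I" using assms subspace_diff[OF I] by (simp add: ideal_of_iff)
qed

lemma ideal_subspace: "ideal_of I T \<Longrightarrow> subspace I"
  and ideal_subset: "ideal_of I T \<Longrightarrow> I \<subseteq> T"
  by (auto simp: ideal_of_iff)

definition essential :: "'a set \<Rightarrow> 'a set \<Rightarrow> bool" where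
  "essential T I \<longleftrightarrow> ideal_of I T \<and> (\<forall>B. ideal_of B T \<longrightarrow> I \<inter> B = {0} \<longrightarrow> B = {0})"

lemma essential_ideal: "essential T I \<Longrightarrow> ideal_of I T"
  by (simp add: essential_def)

lemma ideal_inter: "ideal_of I T \<Longrightarrow> ideal_of J T \<Longrightarrow> ideal_of (I \<inter> J) T"
  unfolding ideal_of_iff using subspace_inter[of I J] by blast

lemma essential_inter:
  assumes "essential T I" "essential T J"
  shows "essential T (I \<inter> J)"
  unfolding essential_def
proof (intro conjI allI impI)
  show "ideal_of (I \<inter> J) T" using ideal_inter[OF assms[THEN essential_ideal]] .
  fix B assume B: "ideal_of B T" "(I \<inter> J) \<inter> B = {0}"
  have "ideal_of (J \<inter> B) T" using ideal_inter[OF essential_ideal[OF assms(2)] B(1)] .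
  moreover have "I \<inter> (J \<inter> B) = {0}" using B(2) by (simp only: inf_assoc)
  ultimately have "J \<inter> B = {0}" using assms(1) unfolding essential_def by blast
  then show "B = {0}" using assms(2) B(1) unfolding essential_def by blast
qed

text \<open>Any bracket with two entries in I lies in [T, I, I], and the derivation rule turns
  [[u, z, w], x, y] into such brackets.\<close>

lemma ideal_bracket:
  assumes T: "subsystem T" and I: "ideal_of I T"
  shows "ideal_of (bracket T I I) T"
proof -
  note subI = ideal_subspace[OF I] and IT = subsetD[OF ideal_subset[OF I]]
  note sub = subspace_bracket[of T I I]
  have ITI: "br x t y \<in> bracket T I I" "br x y t \<in> bracket T I I"
    if "x \<in> I" "t \<in> T" "y \<in> I" for x t y
  proof -
    show 1: "br x t y \<in> bracket T I I"
      using br_in_bracket[of t T x I y I] that br_skew[of x t y] subspace_neg[OF sub] by simp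
    show "br x y t \<in> bracket T I I"
      using br_in_bracket[of t T x I y I] br_in_bracket[of t T y I x I] that br_skew[of y t x]
        br_cyclic[of x y t] subspace_diff[OF sub] by simp
  qed
  have "br (br u z w) x y \<in> bracket T I I" if "u \<in> T" "z \<in> I" "w \<in> I" "x \<in> T" "y \<in> T" for u z w x y
  proof -
    have "br (br u z w) x y = br u z (br w x y) - br w (br u z x) y - br w x (br u z y)"
      using derivation[of u z w x y] by (simp add: algebra_simps)
    moreover have "br u z (br w x y) \<in> bracket T I I"
      using that ideal_br[OF I] by (intro br_in_bracket) auto
    moreover have "br w (br u z x) y \<in> bracket T I I"
      using that ideal_br[OF I] by (intro ITI) auto
    moreover have "br w x (br u z y) \<in> bracket T I I"
      using that ideal_br[OF I] by (intro ITI) auto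
    ultimately show ?thesis using subspace_diff[OF sub] by simp
  qed
  then have "bracket T I I \<subseteq> {k. br k x y \<in> bracket T I I}" if "x \<in> T" "y \<in> T" for x y
    using that sub
    by (subst bracket_subset_iff)
      (auto simp: subspace_def br_linear br_more)
  moreover have "bracket T I I \<subseteq> T"
    using bracket_subset_iff[OF subspT[OF T], of T I I] brT[OF T] IT by blast
  ultimately show ?thesis using sub by (simp add: ideal_of_iff subset_iff)
qed

lemma bracket_subset_ideal:
  assumes "ideal_of I T" shows "bracket T I I \<subseteq> I"
  using assms ideal_br[OF assms] ideal_subset[OF assms]
  by (subst bracket_subset_iff) (auto simp: ideal_subspace)

lemma bracket_mono: "A \<subseteq> A' \<Longrightarrow> B \<subseteq> B' \<Longrightarrow> C \<subseteq> C' \<Longrightarrow> bracket A B C \<subseteq> bracket A' B' C'"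
  unfolding bracket_def by (rule span_mono) blast

text \<open>If B meets [T, I, I] in 0, then [T, K, K] = 0 for the ideal K = I \<inter> B, so K = 0
  by semiprimeness and B = 0.\<close>

lemma essential_bracket:
  assumes T: "subsystem T" "semiprime T" and I: "essential T I"
  shows "essential T (bracket T I I)"
  unfolding essential_def
proof (intro conjI allI impI)
  show "ideal_of (bracket T I I) T"
    using ideal_bracket T(1) I by (simp add: essential_def)
  fix B assume B: "ideal_of B T" "bracket T I I \<inter> B = {0}"
  let ?J = "I \<inter> B"
  have J: "ideal_of ?J T" using I B ideal_inter by (simp add: essential_def)
  have "bracket T ?J ?J \<subseteq> bracket T I I" by (intro bracket_mono) auto
  moreover have "bracket T ?J ?J \<subseteq> B" using bracket_subset_ideal[OF J] by blast
  ultimately have "bracket T ?J ?J = {0}"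
    using B subspace_0[OF subspace_bracket] by blast
  then have "?J = {0}" using T(2) J unfolding semiprime_def by blast
  then show "B = {0}" using I B unfolding essential_def by blast
qed

text \<open>The definition speaks of sums from two spans; as both contain 0, the condition splits
  into one for each.\<close>

lemma colon_iff:
  assumes "subspace T"
  shows "x \<in> colon T s \<longleftrightarrow> x \<in> T \<and> (\<forall>t\<in>T. \<forall>m\<in>generated T s. br x t m \<in> T \<and> br x m t \<in> T)"
proof -
  have "{a + b | a b. a \<in> A \<and> b \<in> B} \<subseteq> T \<longleftrightarrow> A \<subseteq> T \<and> B \<subseteq> T"
    if "subspace A" "subspace B" for A B
  proof
    assume *: "{a + b | a b. a \<in> A \<and> b \<in> B} \<subseteq> T"
    have "a + 0 \<in> T" if "a \<in> A" for a
      using * that subspace_0[OF \<open>subspace B\<close>] by blast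
    moreover have "0 + b \<in> T" if "b \<in> B" for b
      using * that subspace_0[OF \<open>subspace A\<close>] by blast
    ultimately show "A \<subseteq> T \<and> B \<subseteq> T" by auto
  qed (use assms subspace_add in blast)
  from this[OF subspace_bracket subspace_bracket] show ?thesis
    using assms by (simp add: colon_def bracket_subset_iff) blast
qed

lemma ideal_colon:
  assumes T: "subsystem T"
  shows "ideal_of (colon T s) T"
  unfolding ideal_of_iff
proof (intro conjI ballI)
  note sub = subspT[OF T] and cl = T_closed[OF T]
  note colon = colon_iff[OF sub]
  show "subspace (colon T s)"
    using sub by (auto simp: subspace_def colon br_linear br_more)
  show "colon T s \<subseteq> T" by (auto simp: colon)
  fix x t u assume x: "x \<in> colon T s" and t: "t \<in> T" and u: "u \<in> T"
  have xT: "x \<in> T" using x by (simp add: colon)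
  have x1: "br x v m \<in> T" "br x m v \<in> T" if "v \<in> T" "m \<in> generated T s" for v m
    using x that by (auto simp: colon)
  have x2: "br v m x \<in> T" if "v \<in> T" "m \<in> generated T s" for v m
    using br_cyclic[of v m x] br_skew[of m x v] x1[OF that] cl by simp
  \<comment> \<open>All three terms of the derivation rule for \<open>[v, m, -]\<close> lie in \<open>T\<close>, although \<open>[v, m, -]\<close> need not map \<open>T\<close> into \<open>T\<close>.\<close>
  have k: "br v m (br x t u) \<in> T" if "v \<in> T" "m \<in> generated T s" for v m
    unfolding derivation[of v m x t u]
    using that t u x1 x2 cl(6) generated_closed'[where T = T and s = s] xT
    by (intro cl(2)) (auto simp: generated_closed)
  show "br x t u \<in> colon T s"
    unfolding colon
  proof (intro conjI ballI)
    show "br x t u \<in> T" using xT t u cl by simp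
    fix v m assume v: "v \<in> T" and m: "m \<in> generated T s"
    have "br (br x t u) m v = br x t (br u m v) - br u (br x t m) v - br u m (br x t v)"
      using derivation[of x t u m v] by (simp add: algebra_simps)
    moreover have "br u m (br x t v) \<in> T"
      unfolding derivation[of u m x t v]
      using v t u m x1 x2 cl(6) generated_closed'[where T = T and s = s] xT
      by (intro cl(2)) (auto simp: generated_closed)
    ultimately show 1: "br (br x t u) m v \<in> T"
      using v m t u x1 cl generated_closed'[where T = T and s = s] by simp
    show "br (br x t u) v m \<in> T"
      using 1 k[OF v m] br_cyclic[of "br x t u" v m] br_skew[of m "br x t u" v] cl by simp
  qed
qed

lemma br_colon:
  assumes "subspace T" "x \<in> colon T s" "t \<in> T" "m \<in> generated T s"
  shows "br x t m \<in> T" "br x m t \<in> T"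
  using assms colon_iff by auto

text \<open>If B meets (T : s) in 0, then [b, x, y] = 0 whenever x or y lies in (T : s), since such
  a bracket lies in both ideals. The quotient condition for the pair b, s excludes this for nonzero
  b.\<close>

lemma essential_colon:
  assumes T: "subsystem T" and q: "system_of_quotients T"
  shows "essential T (colon T s)"
  unfolding essential_def
proof (intro conjI allI impI)
  note C = ideal_colon[OF T, of s]
  show "ideal_of (colon T s) T" by (rule C)
  fix B assume B: "ideal_of B T" and disj: "colon T s \<inter> B = {0}"
  have zero: "br b x y = 0" if "b \<in> B" "x \<in> T" "y \<in> T" "x \<in> colon T s \<or> y \<in> colon T s" for b x y
  proof -
    have "b \<in> T" using that(1) ideal_subset[OF B] by blast
    then have "br b x y \<in> colon T s" using that(2-4) ideal_br[OF C] by auto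
    moreover have "br b x y \<in> B" using that ideal_br[OF B] by auto
    ultimately show ?thesis using disj by blast
  qed
  have "b = 0" if b: "b \<in> B" for b
  proof (rule ccontr)
    assume "b \<noteq> 0"
    then obtain x y where "x \<in> T" "y \<in> T" "br b x y \<noteq> 0" "x \<in> colon T s \<or> y \<in> colon T s"
      using q unfolding system_of_quotients_def by blast
    then show False using zero[OF b] by blast
  qed
  then show "B = {0}" using subspace_0[OF ideal_subspace[OF B]] by blast
qed

lemma essential_T:
  assumes "subsystem T" shows "essential T T"
  using assms ideal_subset by (auto simp: essential_def ideal_of_iff subsystem_iff inf_absorb2)

section \<open>Operators on S and products in L(S)\<close>

lemma lops_UNIV:
  assumes "D \<in> lops UNIV"
  shows "D (x + y) = D x + D y" "D (x - y) = D x - D y" "D (- x) = - D x" "D 0 = 0"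
    and "D (scale c x) = scale c (D x)"
    and "D (br x y z) = br (D x) y z + br x (D y) z + br x y (D z)"
proof -
  show "D (x + y) = D x + D y" using assms by (rule lops_plus[OF subsystem_UNIV]) auto
  show "D (x - y) = D x - D y" using assms by (rule lops_minus[OF subsystem_UNIV]) auto
  show 0: "D 0 = 0" using assms by (rule lops_zero[OF subsystem_UNIV])
  show "D (- x) = - D x"
    using lops_minus[OF subsystem_UNIV assms, of 0 x] 0 by simp
  show "D (scale c x) = scale c (D x)" using assms by (rule lops_smult[OF subsystem_UNIV]) auto
  show "D (br x y z) = br (D x) y z + br x (D y) z + br x y (D z)"
    using assms by (rule lops_derivation[OF subsystem_UNIV]) auto
qed

lemma lop_UNIV: "lop UNIV x y z = br x y z"
  by (simp add: lop_def)

lemma lop_UNIV_linear: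
  "lop UNIV (x + x') y = lop UNIV x y + lop UNIV x' y"
  "lop UNIV x (y + y') = lop UNIV x y + lop UNIV x y'"
  "lop UNIV (- x) y = - lop UNIV x y" "lop UNIV x (- y) = - lop UNIV x y"
  "lop UNIV (scale c x) y = op_scale c (lop UNIV x y)"
  "lop UNIV x (scale c y) = op_scale c (lop UNIV x y)"
  "lop UNIV 0 y = 0" "lop UNIV x 0 = 0"
  by (auto simp: fun_eq_iff lop_UNIV br_linear br_more op_scale_def)

lemma lop_UNIV_skew: "lop UNIV y x = - lop UNIV x y"
  by (auto simp: fun_eq_iff lop_UNIV br_skew[of x y])

lemma emb_bracket_odd:
  "E \<in> lops UNIV \<Longrightarrow> emb_bracket UNIV (0, x) (E, s) = (lop UNIV x s, - E x)"
  by (auto simp: emb_bracket_def fun_eq_iff lops_UNIV)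

lemma emb_bracket_even:
  "emb_bracket UNIV (F, 0) (E, s) = ((F \<circ> E) - (E \<circ> F), F s - E 0)"
  by (auto simp: emb_bracket_def lop_UNIV_linear)

end

section \<open>Systems of quotients of semiprime systems\<close>

locale quotient_system = lie_triple_system scale br
  for scale :: "'f::field \<Rightarrow> 'a::ab_group_add \<Rightarrow> 'a" and br +
  fixes T :: "'a set"
  assumes sub_T: "subsystem T"
    and semiprime_T: "semiprime T"
    and quotients_T: "system_of_quotients T"
begin

lemmas in_T = T_closed[OF sub_T]

lemma subspace_T: "subspace T" using sub_T by (rule subspT)

lemma ideal_T: "ideal_of T T"
  using essential_T[OF sub_T] by (rule essential_ideal)

lemma quotient_witness:
  assumes "s \<noteq> 0"
  obtains x y where "x \<in> T" "y \<in> T" "br s x y \<noteq> 0" "x \<in> colon T s' \<or> y \<in> colon T s'"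
  using quotients_T assms unfolding system_of_quotients_def by blast

text \<open>Together with \<open>quotient_witness\<close> for s' = s this carries any nonzero s to a
  nonzero element of T.\<close>

lemma br_s_colon:
  assumes "x \<in> T" "y \<in> T" "x \<in> colon T s \<or> y \<in> colon T s"
  shows "br s x y \<in> T"
proof -
  note c = br_colon[OF subspace_T]
  show ?thesis
    using assms(3)
  proof
    assume "x \<in> colon T s"
    then show ?thesis using c(2)[of x s y s] generated_base assms br_skew[of s x y] in_T by simp
  next
    assume y: "y \<in> colon T s"
    have "br s x y = br y x s - br y s x"
      using br_cyclic[of s x y] br_skew[of x y s] by simp
    then show ?thesis using c[OF y assms(1) generated_base] in_T by simp
  qed
qed

lemma zero_if_essential:
  assumes I: "essential T I"
    and s: "\<And>i t. i \<in> I \<Longrightarrow> t \<in> T \<Longrightarrow> br i s t = 0" "\<And>i t. i \<in> I \<Longrightarrow> t \<in> T \<Longrightarrow> br i t s = 0"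
  shows "s = 0"
proof -
  note II = essential_ideal[OF I] and br_I = ideal_br[OF essential_ideal[OF I]]
  have IT: "i \<in> I \<Longrightarrow> i \<in> T" for i using ideal_subset[OF II] by blast
  \<comment> \<open>\<open>A\<close> is closed under \<open>[-, T, T]\<close>, so \<open>A \<inter> I\<close> is an ideal with \<open>[T, A \<inter> I, A \<inter> I] = 0\<close>.\<close>
  define A where "A = {s. \<forall>i\<in>I. \<forall>t\<in>T. br i s t = 0 \<and> br i t s = 0}"
  have subA: "subspace A"
    by (auto simp: subspace_def A_def br_linear br_more)
  have A_closed: "br a u v \<in> A" if a: "a \<in> A" and u: "u \<in> T" and v: "v \<in> T" for a u v
  proof -
    have aI: "br i a t = 0" "br i t a = 0" "br a i t = 0" "br a t i = 0"
      if "i \<in> I" "t \<in> T" for i t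
    proof -
      show *: "br i a t = 0" "br i t a = 0" using a that by (auto simp: A_def)
      show "br a i t = 0" using * br_skew[of a i t] by simp
      show "br a t i = 0" using * br_cyclic[of a t i] br_skew[of t i a] by simp
    qed
    have eq: "br i w (br a u v) = 0" if i: "i \<in> I" and w: "w \<in> T" for i w
      using derivation[of i w a u v] br_I i u v w by (simp add: aI br_more)
    have "br v i (br a u w) = 0" if i: "i \<in> I" and w: "w \<in> T" for i w
      using derivation[of v i a u w] br_I i u v w aI(2)[of i v] by (simp add: aI br_skew[of v i] br_more)
    then have "br (br a u v) i w = 0" if i: "i \<in> I" and w: "w \<in> T" for i w
      using derivation[of a u v i w] br_I i u v w by (simp add: aI br_more)
    then show ?thesis using eq by (auto simp: A_def br_skew[of _ "br a u v"])
  qed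
  have "ideal_of (A \<inter> T) T"
    unfolding ideal_of_iff
    using subspace_inter[OF subA subspace_T] A_closed in_T(6) by simp
  moreover from this have "ideal_of (I \<inter> (A \<inter> T)) T" using II ideal_inter by blast
  moreover have "bracket T (I \<inter> (A \<inter> T)) (I \<inter> (A \<inter> T)) = {0}"
    unfolding bracket_eq_0_iff
  proof (intro ballI)
    fix t a b assume "t \<in> T" "a \<in> I \<inter> (A \<inter> T)" "b \<in> I \<inter> (A \<inter> T)"
    then show "br t a b = 0" using br_skew[of t a b] by (simp add: A_def)
  qed
  ultimately have A0: "A \<inter> T = {0}"
    using semiprime_T I unfolding semiprime_def essential_def by meson
  have sA: "s \<in> A" using s by (simp add: A_def)
  show "s = 0"
  proof (rule ccontr)
    assume "s \<noteq> 0"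
    \<comment> \<open>The quotient condition moves s to a nonzero element of T, and A is closed
      under this move.\<close>
    then obtain x y where xy: "x \<in> T" "y \<in> T" "br s x y \<noteq> 0" "x \<in> colon T s \<or> y \<in> colon T s"
      by (rule quotient_witness)
    then have "br s x y \<in> A \<inter> T" using sA A_closed br_s_colon by blast
    then show False using A0 xy(3) by blast
  qed
qed

text \<open>If D s were nonzero, there would be x, y with [D s, x, y] nonzero and [s, x, y] in T;
  but D sends [s, x, y] to [D s, x, y]. So operators of L(S, S) are determined by their restriction
  to T.\<close>

lemma derivation_zero:
  assumes D: "D \<in> lops UNIV" and z: "\<And>t. t \<in> T \<Longrightarrow> D t = 0"
  shows "D = 0"
proof
  fix s
  show "D s = 0 s"
  proof (rule ccontr)
    assume "D s \<noteq> 0 s"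
    then obtain x y where xy: "x \<in> T" "y \<in> T" "br (D s) x y \<noteq> 0" "x \<in> colon T s \<or> y \<in> colon T s"
      using quotient_witness[of "D s" s] by auto
    have "D (br s x y) = br (D s) x y" using xy z by (simp add: lops_UNIV[OF D] br_more)
    then show False using xy z br_s_colon by auto
  qed
qed

lemma derivation_zero_if_essential:
  assumes E: "E \<in> lops UNIV" and I: "essential T I"
    and EI: "\<And>i. i \<in> I \<Longrightarrow> E i = 0"
    and iE: "\<And>i t u. i \<in> I \<Longrightarrow> t \<in> T \<Longrightarrow> u \<in> T \<Longrightarrow> br i (E t) u = 0"
  shows "E = 0"
proof (rule derivation_zero[OF E])
  fix u assume u: "u \<in> T"
  note br_I = ideal_br[OF essential_ideal[OF I]]
  have IT: "i \<in> I \<Longrightarrow> i \<in> T" for i using ideal_subset[OF essential_ideal[OF I]] by blast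
  show "E u = 0"
  proof (rule zero_if_essential[OF I])
    fix i t assume i: "i \<in> I" and t: "t \<in> T"
    show "br i (E u) t = 0" by (rule iE[OF i u t])
    have "E (br i t u) = 0" using EI br_I i t u by blast
    then show "br i t (E u) = 0"
      using i t u by (simp add: lops_UNIV[OF E] EI iE br_more)
  qed
qed

text \<open>The operators act on all of \<open>S\<close>; thus \<open>inner T \<times> T\<close> is the copy of \<open>L(T)\<close> in \<open>L(S)\<close>.\<close>

definition inner :: "'a set \<Rightarrow> ('a \<Rightarrow> 'a) set" where
  "inner I = module.span op_scale {lop UNIV a b | a b. a \<in> I \<and> b \<in> T}"

lemma inner_0: "0 \<in> inner I"
  and inner_add: "D \<in> inner I \<Longrightarrow> E \<in> inner I \<Longrightarrow> D + E \<in> inner I"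
  and inner_diff: "D \<in> inner I \<Longrightarrow> E \<in> inner I \<Longrightarrow> D - E \<in> inner I"
  and inner_scale: "D \<in> inner I \<Longrightarrow> op_scale c D \<in> inner I"
  and inner_neg: "D \<in> inner I \<Longrightarrow> - D \<in> inner I"
  unfolding inner_def
  by (auto intro: module.span_zero[OF module_op_scale] module.span_add[OF module_op_scale]
      module.span_diff[OF module_op_scale] module.span_scale[OF module_op_scale]
      module.span_neg[OF module_op_scale])

lemma inner_lop:
  assumes "i \<in> I" "t \<in> T"
  shows "lop UNIV i t \<in> inner I" "lop UNIV t i \<in> inner I"
proof -
  show "lop UNIV i t \<in> inner I"
    unfolding inner_def using assms by (intro module.span_base[OF module_op_scale]) blast
  then show "lop UNIV t i \<in> inner I" using lop_UNIV_skew[of t i] inner_neg by simp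
qed

lemma inner_induct [consumes 1, case_names zero add scale lop]:
  assumes "D \<in> inner I" "P 0"
    and "\<And>D E. P D \<Longrightarrow> P E \<Longrightarrow> P (D + E)"
    and "\<And>c D. P D \<Longrightarrow> P (op_scale c D)"
    and "\<And>a b. a \<in> I \<Longrightarrow> b \<in> T \<Longrightarrow> P (lop UNIV a b)"
  shows "P D"
proof -
  have "module.subspace op_scale {D. P D}"
    using assms by (auto simp: module.subspace_def[OF module_op_scale])
  then have "inner I \<subseteq> {D. P D}"
    unfolding inner_def using assms by (intro module.span_minimal[OF module_op_scale]) auto
  then show ?thesis using assms(1) by blast
qed

lemma inner_lops: "D \<in> inner I \<Longrightarrow> D \<in> lops UNIV"
  by (induction rule: inner_induct) (assumption | rule lops_0 lops_add lops_scale lop_in UNIV_I)+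

lemma inner_mono: "D \<in> inner I \<Longrightarrow> I \<subseteq> J \<Longrightarrow> D \<in> inner J"
  by (induction rule: inner_induct) (blast intro: inner_0 inner_add inner_scale inner_lop)+

lemma inner_map:
  assumes "D \<in> inner I" "ideal_of I T" "t \<in> T" shows "D t \<in> I"
  using assms(1)
  by (induction rule: inner_induct)
    (use assms ideal_br ideal_subspace[of I T] in
      \<open>auto simp: lop_UNIV op_scale_def subspace_0 subspace_add subspace_scale\<close>)

lemma inner_T_map:
  assumes "D \<in> inner T" "ideal_of I T" "i \<in> I" shows "D i \<in> I"
  using assms(1)
  by (induction rule: inner_induct)
    (use assms ideal_br ideal_subspace[of I T] in
      \<open>auto simp: lop_UNIV op_scale_def subspace_0 subspace_add subspace_scale\<close>)

lemma comm_lop_UNIV: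
  "D \<in> lops UNIV \<Longrightarrow>
    (D \<circ> lop UNIV a b) - (lop UNIV a b \<circ> D) = lop UNIV (D a) b + lop UNIV a (D b)"
  by (rule comm_lop[OF subsystem_UNIV]) auto

lemma inner_comm:
  assumes D: "D \<in> lops UNIV" and E: "E \<in> inner I"
    and DI: "\<And>i. i \<in> I \<Longrightarrow> D i \<in> I" and DT: "\<And>t. t \<in> T \<Longrightarrow> D t \<in> T"
  shows "(D \<circ> E) - (E \<circ> D) \<in> inner I"
  using E
proof (induction rule: inner_induct)
  case zero
  have "(D \<circ> 0) - (0 \<circ> D) = 0" by (auto simp: fun_eq_iff lops_UNIV[OF D])
  then show ?case by (simp only: inner_0)
next
  case (add E F)
  have "(D \<circ> (E + F)) - ((E + F) \<circ> D) = ((D \<circ> E) - (E \<circ> D)) + ((D \<circ> F) - (F \<circ> D))"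
    by (auto simp: fun_eq_iff lops_UNIV[OF D])
  then show ?case using add by (simp only: inner_add)
next
  case (scale c E)
  have "(D \<circ> op_scale c E) - (op_scale c E \<circ> D) = op_scale c ((D \<circ> E) - (E \<circ> D))"
    by (auto simp: fun_eq_iff lops_UNIV[OF D] op_scale_def algebra_simps)
  then show ?case using scale by (simp only: inner_scale)
next
  case (lop a b)
  then show ?case using DI DT by (simp only: comm_lop_UNIV[OF D] inner_add inner_lop)
qed

section \<open>Iterated products of ideals inside (T : s) that absorb elements and operators of
  S\<close>

lemma br_colon_all:
  assumes "I \<subseteq> colon T s" "i \<in> I" "t \<in> T" "m \<in> generated T s"
  shows "br i t m \<in> T" "br i m t \<in> T" "br t i m \<in> T" "br m t i \<in> T"
proof -
  show 1: "br i t m \<in> T" "br i m t \<in> T" using assms br_colon[OF subspace_T] by blast+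
  show "br t i m \<in> T" using 1 br_skew[of t i m] in_T by simp
  show "br m t i \<in> T" using 1 br_cyclic[of m t i] br_skew[of t i m] in_T by simp
qed

text \<open>The commutator of [w, m, -] and [u, z, -] is computed in two ways. For z, w in (T : s)
  and m generated by s, the right side has all its entries in T.\<close>

lemma lop_bracket:
  "lop UNIV (br u z w) m =
    - (lop UNIV (br w m u) z + lop UNIV u (br w m z)) - lop UNIV w (br u z m)"
proof
  fix x
  show "lop UNIV (br u z w) m x =
      (- (lop UNIV (br w m u) z + lop UNIV u (br w m z)) - lop UNIV w (br u z m)) x"
    using derivation[of w m u z x] derivation[of u z w m x]
    by (simp add: lop_UNIV algebra_simps eq_neg_iff_add_eq_0)
qed

lemma subspace_lop_inner: "subspace {i. lop UNIV i m \<in> inner I}"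
  by (auto simp: subspace_def lop_UNIV_linear inner_0 inner_add inner_scale)

lemma lop_inner_T:
  assumes I: "ideal_of I T" "I \<subseteq> colon T s" and m: "m \<in> generated T s"
    and i: "i \<in> bracket T I I"
  shows "lop UNIV i m \<in> inner T"
proof -
  have IT: "i \<in> I \<Longrightarrow> i \<in> T" for i using ideal_subset[OF I(1)] by blast
  have "lop UNIV (br u z w) m \<in> inner T" if "u \<in> T" "z \<in> I" "w \<in> I" for u z w
    unfolding lop_bracket[of u z w]
    using that br_colon_all[OF I(2) _ _ m] IT
    by (intro inner_diff inner_neg inner_add inner_lop) auto
  then have "bracket T I I \<subseteq> {i. lop UNIV i m \<in> inner T}"
    by (simp add: bracket_subset_iff[OF subspace_lop_inner])
  then show ?thesis using i by blast
qed

text \<open>For w in I the derivation [w, m, -] maps T into T, so each term of the derivation rule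
  keeps an entry from I.\<close>

lemma br_in_ideal:
  assumes I: "ideal_of I T" "I \<subseteq> colon T s" and m: "m \<in> generated T s"
    and w: "w \<in> I" and z: "z \<in> bracket T I I"
  shows "br w m z \<in> I"
proof -
  note sub = ideal_subspace[OF I(1)]
  have IT: "i \<in> I \<Longrightarrow> i \<in> T" for i using ideal_subset[OF I(1)] by blast
  have "br w m (br u x y) \<in> I" if "u \<in> T" "x \<in> I" "y \<in> I" for u x y
    unfolding derivation[of w m u x y]
    using that br_colon_all[OF I(2) w _ m] IT ideal_br[OF I(1)]
    by (intro subspace_add[OF sub]) auto
  then have "bracket T I I \<subseteq> {z. br w m z \<in> I}"
    using sub by (subst bracket_subset_iff) (auto simp: subspace_def br_linear br_more)
  then show ?thesis using z by blast
qed

text \<open>The second product puts the entry [w, m, z] of \<open>lop_bracket\<close> into I, by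
  \<open>br_in_ideal\<close>.\<close>

lemma lop_inner_ideal:
  assumes I: "ideal_of I T" "I \<subseteq> colon T s" and m: "m \<in> generated T s"
    and i: "i \<in> bracket T (bracket T I I) (bracket T I I)"
  shows "lop UNIV i m \<in> inner I"
proof -
  let ?J = "bracket T I I"
  have IT: "i \<in> I \<Longrightarrow> i \<in> T" for i using ideal_subset[OF I(1)] by blast
  have JI: "j \<in> ?J \<Longrightarrow> j \<in> I" for j using bracket_subset_ideal[OF I(1)] by blast
  have "lop UNIV (br u z w) m \<in> inner I" if "u \<in> T" "z \<in> ?J" "w \<in> ?J" for u z w
  proof -
    have "lop UNIV (br w m u) z \<in> inner I" "lop UNIV w (br u z m) \<in> inner I"
      using that br_colon_all[OF I(2) _ _ m] JI by (auto intro: inner_lop)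
    moreover have "lop UNIV u (br w m z) \<in> inner I"
      using that br_in_ideal[OF I m] JI by (auto intro: inner_lop)
    ultimately show ?thesis
      unfolding lop_bracket[of u z w] by (intro inner_diff inner_neg inner_add)
  qed
  then have "bracket T ?J ?J \<subseteq> {i. lop UNIV i m \<in> inner I}"
    by (simp add: bracket_subset_iff[OF subspace_lop_inner])
  then show ?thesis using i by blast
qed

text \<open>The derivation [m, t, -] need not preserve T. But [m, t, u] is again generated by s, so
  \<open>lop_inner_T\<close> controls that term of the derivation rule.\<close>

lemma br_generated_ideal:
  assumes I: "ideal_of I T" "I \<subseteq> colon T s" and m: "m \<in> generated T s" and t: "t \<in> T"
    and z: "z \<in> bracket T (bracket T I I) (bracket T I I)"
  shows "br m t z \<in> bracket T I I"
proof -
  let ?J = "bracket T I I"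
  note J = ideal_bracket[OF sub_T I(1)] and sub = subspace_bracket[of T I I]
  have JT: "j \<in> ?J \<Longrightarrow> j \<in> T" for j using ideal_subset[OF J] by blast
  have JI: "j \<in> ?J \<Longrightarrow> j \<in> I" for j using bracket_subset_ideal[OF I(1)] by blast
  have "br m t (br u x y) \<in> ?J" if u: "u \<in> T" and x: "x \<in> ?J" and y: "y \<in> ?J" for u x y
  proof -
    have m': "br m t u \<in> generated T s" using m t u by (rule generated_closed[rotated 2])
    have "lop UNIV x (br m t u) y \<in> ?J"
      using lop_inner_T[OF I m' x] J y by (rule inner_T_map)
    then have "br (br m t u) x y \<in> ?J"
      using br_skew[of "br m t u" x y] subspace_neg[OF sub] by (simp add: lop_UNIV)
    then show ?thesis
      unfolding derivation[of m t u x y]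
      using u x y br_colon_all[OF I(2) JI t m] JT ideal_br[OF J]
      by (intro subspace_add[OF sub]) auto
  qed
  then have "bracket T ?J ?J \<subseteq> {z. br m t z \<in> ?J}"
    using sub by (subst bracket_subset_iff) (auto simp: subspace_def br_linear br_more)
  then show ?thesis using z by blast
qed

text \<open>The two properties say that brackets of E with I and with [I, T] stay in the copy of
  L(T). Sums are handled by intersecting ideals; the generators [a, b, -] need three nested
  products.\<close>

lemma exists_good_op:
  assumes "E \<in> lops UNIV"
  shows "\<exists>I. essential T I \<and> (\<forall>i\<in>I. E i \<in> T \<and> (\<forall>t\<in>T. lop UNIV i (E t) \<in> inner T))"
  using assms
proof (induction rule: lops_induct)
  case zero
  show ?case
    proof (intro exI conjI ballI)
    show "essential T T" by (rule essential_T[OF sub_T])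
    fix i t :: 'a show "0 i \<in> T" using in_T(1) by simp
    show "lop UNIV i (0 t) \<in> inner T"
      using inner_0 by (simp only: zero_fun_apply[of t] lop_UNIV_linear)
  qed
next
  case (add D E)
  then obtain I J where
    I: "essential T I" "\<forall>i\<in>I. D i \<in> T \<and> (\<forall>t\<in>T. lop UNIV i (D t) \<in> inner T)" and
    J: "essential T J" "\<forall>i\<in>J. E i \<in> T \<and> (\<forall>t\<in>T. lop UNIV i (E t) \<in> inner T)"
    by blast
  have "lop UNIV i ((D + E) t) \<in> inner T" if "i \<in> I \<inter> J" "t \<in> T" for i t
    using that I J inner_add by (simp only: plus_fun_apply[of D E t] lop_UNIV_linear) blast
  then show ?case
    using I J in_T(2) by (intro exI[of _ "I \<inter> J"]) (simp add: essential_inter)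
next
  case (scale c D)
  then show ?case
    using in_T(4) by (auto simp: op_scale_def[of c D] lop_UNIV_linear inner_scale)
next
  case (lop a b)
  \<comment> \<open>One product makes \<open>lopJ\<close> work on J; the two further ones, down to
    J3, force brackets with a or b into J.\<close>
  define I where "I = colon T a \<inter> colon T b"
  have I: "essential T I"
    unfolding I_def by (intro essential_inter essential_colon sub_T quotients_T)
  define J where "J = bracket T I I"
  define J2 where "J2 = bracket T J J"
  define J3 where "J3 = bracket T J2 J2"
  have J: "essential T J" "essential T J2" "essential T J3"
    unfolding J3_def J2_def J_def by (intro essential_bracket sub_T semiprime_T I)+
  note II = I[THEN essential_ideal] and JI = J[THEN essential_ideal]
  have JJ: "J \<subseteq> I" "J2 \<subseteq> J" "J3 \<subseteq> J2"
    unfolding J3_def J2_def J_def using II JI by (auto simp: J2_def J_def bracket_subset_ideal)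
  have m: "s \<in> generated T s" for s by (rule generated_base)
  have Ia: "I \<subseteq> colon T a" and Ib: "I \<subseteq> colon T b" by (auto simp: I_def)
  have ab: "br i t s \<in> J \<and> lop UNIV i s \<in> inner I" if i: "i \<in> J3" and t: "t \<in> T" and s: "I \<subseteq> colon T s" for i t s
  proof -
    have Js: "J \<subseteq> colon T s" using s JJ by blast
    have "br s t i \<in> J"
      using br_generated_ideal[OF JI(1) Js m t, of i] bracket_subset_ideal[OF JI(1)] i
      by (auto simp: J3_def J2_def)
    moreover have "lop UNIV i s \<in> inner J"
      using lop_inner_ideal[OF JI(1) Js m, of i] i by (simp add: J3_def J2_def)
    moreover from this have "br i s t \<in> J" using inner_map[OF _ JI(1) t] by (fastforce simp: lop_UNIV)
    moreover have "br i t s = br s t i + br i s t"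
      using br_cyclic[of i t s] br_skew[of t s i] br_skew[of s i t] by simp
    ultimately show ?thesis
      using subspace_add[OF subspace_bracket, of "br s t i" T I I "br i s t"] JJ
      by (auto simp: J_def intro: inner_mono)
  qed
  have lopJ: "lop UNIV j s \<in> inner T" if "j \<in> J" "I \<subseteq> colon T s" for j s
    using lop_inner_T[OF II that(2) m] that(1) by (simp add: J_def)
  have inT: "D s \<in> T" if D: "D \<in> inner I" and s: "I \<subseteq> colon T s" for D s
    using D
  proof (induction rule: inner_induct)
    case (lop i t)
    then show ?case using br_colon_all[OF s _ _ m] by (simp add: lop_UNIV)
  qed (auto simp: in_T op_scale_def)
  have "lop UNIV a b i \<in> T \<and> (\<forall>t\<in>T. lop UNIV i (lop UNIV a b t) \<in> inner T)" if i: "i \<in> J3" for i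
  proof (intro conjI ballI)
    have "lop UNIV a b i = br i b a - br i a b"
      using br_cyclic[of a b i] br_skew[of b i a] by (simp add: lop_UNIV)
    moreover have "br i b a \<in> T" "br i a b \<in> T"
      using inT[of "lop UNIV i b" a] inT[of "lop UNIV i a" b] ab[OF i in_T(1)] Ia Ib by (auto simp: lop_UNIV)
    ultimately show abi: "lop UNIV a b i \<in> T" using in_T(3) by simp
    fix t assume t: "t \<in> T"
    \<comment> \<open>The derivation rules for [i, t, -] and [a, b, -] combine so that a and b occur
      as entries only beside elements of J, apart from [a, b, i], which lies in T.\<close>
    have "lop UNIV i (lop UNIV a b t) =
        - (lop UNIV (br i t a) b - lop UNIV (br i t b) a) - lop UNIV (lop UNIV a b i) t"
    proof
      fix x
      show "lop UNIV i (lop UNIV a b t) x =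
        (- (lop UNIV (br i t a) b - lop UNIV (br i t b) a) - lop UNIV (lop UNIV a b i) t) x"
        using derivation[of i t a b x] derivation[of a b i t x] br_skew[of a "br i t b" x]
        by (simp add: lop_UNIV algebra_simps)
    qed
    moreover have "lop UNIV (br i t a) b \<in> inner T" "lop UNIV (br i t b) a \<in> inner T"
      using ab[OF i t] lopJ Ia Ib by auto
    ultimately show "lop UNIV i (lop UNIV a b t) \<in> inner T"
      using abi t by (simp only: inner_diff inner_neg inner_lop)
  qed
  then show ?case using J(3) by blast
qed

text \<open>This is the counterpart of \<open>exists_good_op\<close> for the odd component of an
  element of L(S).\<close>

lemma exists_good_element:
  shows "\<exists>I. essential T I \<and> (\<forall>i\<in>I. lop UNIV i s \<in> inner T \<and> (\<forall>t\<in>T. br i t s \<in> T))"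
proof (intro exI conjI ballI)
  let ?I = "colon T s"
  have I: "essential T ?I" by (intro essential_colon sub_T quotients_T)
  then show "essential T (bracket T ?I ?I)" by (intro essential_bracket sub_T semiprime_T)
  fix i assume i: "i \<in> bracket T ?I ?I"
  show "lop UNIV i s \<in> inner T"
    using lop_inner_T[OF essential_ideal[OF I] order_refl generated_base i] .
  fix t assume "t \<in> T"
  then show "br i t s \<in> T"
    using br_colon[OF subspace_T _ _ generated_base] i
      bracket_subset_ideal[OF essential_ideal[OF I]] by blast
qed

section \<open>L(S) as an algebra of quotients of the copy of L(T)\<close>

interpretation emb: lie_algebra emb_scale "std_embedding UNIV" "emb_bracket UNIV"
  by (rule lie_algebra_std_embedding[OF subsystem_UNIV])

lemma inner_subset: "I \<subseteq> T \<Longrightarrow> inner I \<times> I \<subseteq> inner T \<times> T"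
  using inner_mono by blast

lemma inner_emb: "inner I \<times> I \<subseteq> std_embedding UNIV"
  using inner_lops by (auto simp: std_embedding_def)

lemma subspace_inner:
  assumes "subspace I" shows "emb.subspace (inner I \<times> I)"
  using assms unfolding emb.subspace_def subspace_def
  by (auto simp: emb_scale_def zero_prod_def plus_prod_def
      simp del: zero_fun_apply intro: inner_0 inner_add inner_scale)

lemma emb_bracket_inner:
  assumes I: "ideal_of I T" and p: "p \<in> inner I \<times> I" and q: "q \<in> inner T \<times> T"
  shows "emb_bracket UNIV p q \<in> inner I \<times> I"
proof -
  obtain F i D t where pq: "p = (F, i)" "q = (D, t)" and
    F: "F \<in> inner I" "i \<in> I" and D: "D \<in> inner T" "t \<in> T"
    using p q by auto
  have "(D \<circ> F) - (F \<circ> D) \<in> inner I"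
    using D F I by (intro inner_comm inner_lops) (auto intro: inner_T_map ideal_T)
  then have "(F \<circ> D) - (D \<circ> F) \<in> inner I" using inner_neg by fastforce
  moreover have "F t - D i \<in> I"
    using F D I inner_map inner_T_map subspace_diff[OF ideal_subspace[OF I]] by auto
  ultimately show ?thesis
    using F D by (simp add: pq emb_bracket_def inner_add inner_lop)
qed

theorem algebra_of_quotients_inner:
  "algebra_of_quotients emb_scale (std_embedding UNIV) (emb_bracket UNIV) (inner T \<times> T)"
proof -
  let ?L = "inner T \<times> T"
  have sub: "emb.subspace ?L" by (rule subspace_inner[OF subspace_T])
  have "emb.subalgebra ?L"
    unfolding emb.subalgebra_def
    using sub inner_emb emb_bracket_inner[OF ideal_T] emb.lbracket_subset_iff[OF sub] by blast
  then show ?thesis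
  \<comment> \<open>The characterization by ideals is used, with the graded ideal [I, T] + I for an
    essential I that absorbs both components of q.\<close>
  proof (rule iffD2[OF emb.algebra_of_quotients_iff], intro ballI impI)
    fix q assume q: "q \<in> std_embedding UNIV" and q0: "q \<noteq> 0"
    obtain E s where qE: "q = (E, s)" and E: "E \<in> lops UNIV"
      using q by (auto simp: std_embedding_def)
    obtain I1 where I1: "essential T I1"
      "\<forall>i\<in>I1. E i \<in> T \<and> (\<forall>t\<in>T. lop UNIV i (E t) \<in> inner T)"
      using exists_good_op[OF E] by blast
    obtain I2 where I2: "essential T I2"
      "\<forall>i\<in>I2. lop UNIV i s \<in> inner T \<and> (\<forall>t\<in>T. br i t s \<in> T)"
      using exists_good_element by blast
    define I where "I = I1 \<inter> I2"
    have I: "essential T I" using I1 I2 essential_inter by (simp add: I_def)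
    note II = essential_ideal[OF I]
    have IT: "i \<in> I \<Longrightarrow> i \<in> T" for i using ideal_subset[OF II] by blast
    let ?J = "inner I \<times> I"
    have subJ: "emb.subspace ?J" by (rule subspace_inner[OF ideal_subspace[OF II]])
    have ideal: "emb.lie_ideal_of ?J ?L"
      unfolding emb.lie_ideal_of_def
      using subJ inner_subset[OF ideal_subset[OF II]] emb_bracket_inner[OF II]
        emb.lbracket_subset_iff[OF subJ] by blast
    \<comment> \<open>Stated for all of L(S), this serves twice: for the centralizer in L(T), and
      for a nonzero bracket of the ideal with q.\<close>
    have faithful: "p = 0"
      if p: "p \<in> std_embedding UNIV" and J: "\<And>j. j \<in> ?J \<Longrightarrow> emb_bracket UNIV j p = 0" for p
    proof -
      obtain D u where pD: "p = (D, u)" and D: "D \<in> lops UNIV"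
        using p by (auto simp: std_embedding_def)
      have odd: "lop UNIV i u = 0" "D i = 0" if "i \<in> I" for i
        using J[of "(0, i)"] that inner_0 emb_bracket_odd[OF D, of i u]
        by (auto simp: pD zero_prod_def)
      have "lop UNIV i t \<circ> D = D \<circ> lop UNIV i t \<and> br i t u = 0" if "i \<in> I" "t \<in> T" for i t
        using J[of "(lop UNIV i t, 0)"] that inner_lop subspace_0[OF ideal_subspace[OF II]]
          emb_bracket_even[of "lop UNIV i t" D u]
        by (auto simp: pD zero_prod_def lops_UNIV[OF D] lop_UNIV)
      then have even: "lop UNIV i t \<circ> D = D \<circ> lop UNIV i t" "br i t u = 0" if "i \<in> I" "t \<in> T" for i t
        using that by auto
      have comm: "br i t (D x) = D (br i t x)" if "i \<in> I" "t \<in> T" for i t x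
        using fun_cong[OF even(1)[OF that], of x] by (simp add: lop_UNIV)
      have "u = 0"
      proof (rule zero_if_essential[OF I])
        fix i t assume it: "i \<in> I" "t \<in> T"
        show "br i u t = 0" using fun_cong[OF odd(1)[OF it(1)], of t] by (simp add: lop_UNIV)
        show "br i t u = 0" using it by (rule even(2))
      qed
      moreover have "D = 0"
      proof (rule derivation_zero_if_essential[OF D I odd(2)])
        fix i t x assume it: "i \<in> I" "t \<in> T" "x \<in> T"
        show "br i (D t) x = 0"
          using comm[OF it(1,2), of x] odd(2)[OF it(1)]
          by (simp add: lops_UNIV[OF D] br_more)
      qed
      ultimately show ?thesis by (simp add: pD zero_prod_def)
    qed
    have "emb.centralizer ?L ?J = {0}"
    proof -
      have "p = 0" if p: "p \<in> ?L" and J: "\<forall>j\<in>?J. emb_bracket UNIV p j = 0" for p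
      proof (rule faithful)
        show pQ: "p \<in> std_embedding UNIV" using p inner_emb by blast
        fix j assume j: "j \<in> ?J"
        then have "j \<in> std_embedding UNIV" using inner_emb by blast
        then show "emb_bracket UNIV j p = 0" using emb.anticomm[of j p] pQ J j by simp
      qed
      moreover have "emb_bracket UNIV 0 j = 0" if "j \<in> ?J" for j
        using emb.zero_left[of j] that inner_emb by blast
      ultimately show ?thesis
        using emb.subspace_0[OF sub] unfolding emb.centralizer_def emb.lbracket_eq_0_iff by blast
    qed
    moreover have "emb.lbracket ?J {q} \<noteq> {0}"
      using faithful[OF q] q0 by (auto simp: emb.lbracket_eq_0_iff)
    moreover have "emb.lbracket ?J {q} \<subseteq> ?L"
    proof -
      have odd: "emb_bracket UNIV (0, i) q \<in> ?L" if "i \<in> I" for i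
        using that I1 I2 in_T(5) by (auto simp: qE emb_bracket_odd[OF E] I_def)
      \<comment> \<open>Membership in \<open>lops UNIV\<close> is carried along because additivity
        of the product holds only inside L(S).\<close>
      have "F \<in> lops UNIV \<and> emb_bracket UNIV (F, 0) q \<in> ?L" if "F \<in> inner I" for F
        using that
      proof (induction rule: inner_induct)
        case zero
        have "emb_bracket UNIV (0, 0) q = (0, 0)"
          using emb.zero_left[OF q] by (simp only: zero_prod_def)
        then show ?case using inner_0 lops_0 in_T(1) by (simp only: mem_Times_iff fst_conv snd_conv)
      next
        case (add F G)
        then have "emb_bracket UNIV ((F, 0) + (G, 0)) q = emb_bracket UNIV (F, 0) q + emb_bracket UNIV (G, 0) q"
          using q by (intro emb.add_left) (auto simp: std_embedding_def)
        then show ?case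
          using add emb.subspace_add[OF sub] lops_add
          by (simp only: add_Pair add_0_left)
      next
        case (scale c F)
        then have "emb_bracket UNIV (emb_scale c (F, 0)) q = emb_scale c (emb_bracket UNIV (F, 0) q)"
          using q by (intro emb.scale_left) (auto simp: std_embedding_def)
        then show ?case
          using scale emb.subspace_scale[OF sub] lops_scale
          by (simp only: emb_scale_def fst_conv snd_conv scale_zero_right)
      next
        case (lop i t)
        have "(lop UNIV i t \<circ> E) - (E \<circ> lop UNIV i t) = - (lop UNIV (E i) t + lop UNIV i (E t))"
          using comm_lop_UNIV[OF E, of i t] by (metis minus_diff_eq)
        moreover have "lop UNIV (E i) t + lop UNIV i (E t) \<in> inner T"
          using lop I1 by (intro inner_add) (auto simp: I_def intro: inner_lop(1))
        moreover have "lop UNIV i t s - E 0 \<in> T"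
          using lop I2 by (simp add: lops_UNIV[OF E] lop_UNIV I_def)
        ultimately show ?case
          by (simp only: qE emb_bracket_even mem_Times_iff fst_conv snd_conv lop_in UNIV_I
              inner_neg simp_thms)
      qed
      then have even: "F \<in> lops UNIV" "emb_bracket UNIV (F, 0) q \<in> ?L" if "F \<in> inner I" for F
        using that by auto
      have "emb_bracket UNIV (F, i) q \<in> ?L" if F: "F \<in> inner I" and i: "i \<in> I" for F i
      proof -
        have "emb_bracket UNIV ((F, 0) + (0, i)) q = emb_bracket UNIV (F, 0) q + emb_bracket UNIV (0, i) q"
          using q even(1)[OF F] lops_0 by (intro emb.add_left) (auto simp: std_embedding_def)
        then show ?thesis
          using emb.subspace_add[OF sub even(2)[OF F] odd[OF i]]
          by (simp only: add_Pair add_0_left add_0_right)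
      qed
      then show ?thesis by (auto simp: emb.lbracket_subset_iff[OF sub] simp del: mem_Times_iff)
    qed
    ultimately show "\<exists>I. emb.lie_ideal_of I ?L \<and> emb.centralizer ?L I = {0} \<and>
       emb.lbracket I {q} \<noteq> {0} \<and> emb.lbracket I {q} \<subseteq> ?L"
      using ideal by blast
  qed
qed

section \<open>The canonical embedding of L(T) into L(S)\<close>

definition extend :: "('a \<Rightarrow> 'a) \<Rightarrow> 'a \<Rightarrow> 'a" where
  "extend D = (THE F. F \<in> inner T \<and> (\<forall>z\<in>T. F z = D z))"

text \<open>Two candidates differ by an operator of L(S, S) that vanishes on T, hence by 0. This is
  the well-definedness of the canonical map.\<close>

lemma extend_eq:
  assumes F: "F \<in> inner T" "\<And>z. z \<in> T \<Longrightarrow> F z = D z"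
  shows "extend D = F"
  unfolding extend_def
proof (rule the_equality)
  show "F \<in> inner T \<and> (\<forall>z\<in>T. F z = D z)" using F by blast
  fix G assume G: "G \<in> inner T \<and> (\<forall>z\<in>T. G z = D z)"
  then have "G - F \<in> lops UNIV" using F inner_diff inner_lops by blast
  then have "G - F = 0" using F G by (intro derivation_zero) auto
  then show "G = F" by simp
qed

lemma extend:
  assumes "D \<in> lops T"
  shows "extend D \<in> inner T" "z \<in> T \<Longrightarrow> extend D z = D z"
proof -
  have "\<exists>F\<in>inner T. \<forall>z\<in>T. F z = D z"
    using assms
  proof (induction rule: lops_induct)
    case zero
    show ?case using inner_0 by blast
  next
    case (add D E)
    then obtain F G where "F \<in> inner T" "G \<in> inner T" "\<forall>z\<in>T. F z = D z" "\<forall>z\<in>T. G z = E z"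
      by blast
    then show ?case by (intro bexI[of _ "F + G"] inner_add) auto
  next
    case (scale c D)
    then obtain F where "F \<in> inner T" "\<forall>z\<in>T. F z = D z" by blast
    then show ?case by (intro bexI[of _ "op_scale c F"] inner_scale) (auto simp: op_scale_def)
  next
    case (lop a b)
    then show ?case by (intro bexI[of _ "lop UNIV a b"] inner_lop) (auto simp: lop_def)
  qed
  then obtain F where F: "F \<in> inner T" "\<And>z. z \<in> T \<Longrightarrow> F z = D z" by blast
  then show "extend D \<in> inner T" "z \<in> T \<Longrightarrow> extend D z = D z" using extend_eq[OF F] by auto
qed

text \<open>The default 0 outside T matches the encoding of \<open>lops T\<close>. The lemma
  supplies preimages under \<open>emb_map\<close>.\<close>

lemma inner_restrict:
  assumes "F \<in> inner T" shows "(\<lambda>z. if z \<in> T then F z else 0) \<in> lops T"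
  using assms
proof (induction rule: inner_induct)
  case zero
  have "(\<lambda>z. if z \<in> T then 0 z else 0) = (0 :: 'a \<Rightarrow> 'a)" by auto
  then show ?case by (simp only: lops_0)
next
  case (add D E)
  have "(\<lambda>z. if z \<in> T then (D + E) z else 0) =
      (\<lambda>z. if z \<in> T then D z else 0) + (\<lambda>z. if z \<in> T then E z else 0)" by auto
  then show ?case using add by (simp only: lops_add)
next
  case (scale c D)
  have "(\<lambda>z. if z \<in> T then op_scale c D z else 0) = op_scale c (\<lambda>z. if z \<in> T then D z else 0)"
    by (auto simp: op_scale_def)
  then show ?case using scale by (simp only: lops_scale)
next
  case (lop a b)
  moreover have "(\<lambda>z. if z \<in> T then lop UNIV a b z else 0) = lop T a b"
    by (simp add: lop_def fun_eq_iff)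
  ultimately show ?case by (simp only: lop_in)
qed

definition emb_map :: "('a \<Rightarrow> 'a) \<times> 'a \<Rightarrow> ('a \<Rightarrow> 'a) \<times> 'a" where
  "emb_map p = (extend (fst p), snd p)"

lemma emb_map_image: "emb_map ` std_embedding T = inner T \<times> T"
proof
  show "emb_map ` std_embedding T \<subseteq> inner T \<times> T"
    using extend by (auto simp: emb_map_def std_embedding_def)
  show "inner T \<times> T \<subseteq> emb_map ` std_embedding T"
  proof
    fix p assume p: "p \<in> inner T \<times> T"
    obtain F x where Fx: "p = (F, x)" "F \<in> inner T" "x \<in> T" using p by auto
    let ?D = "\<lambda>z. if z \<in> T then F z else 0"
    have "p = emb_map (?D, x)" using extend_eq[OF Fx(2), of ?D] by (simp add: Fx emb_map_def)
    then show "p \<in> emb_map ` std_embedding T"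
      using inner_restrict[OF Fx(2)] Fx(3) by (auto simp: std_embedding_def)
  qed
qed

lemma canonical_emb_map: "canonical_map T emb_map"
  unfolding canonical_map_def
proof (intro ballI allI impI)
  fix x and ps :: "('a \<times> 'a) list" assume "set ps \<subseteq> T \<times> T"
  then have "(\<Sum>(a, b)\<leftarrow>ps. lop UNIV a b) \<in> inner T \<and>
      (\<forall>z\<in>T. (\<Sum>(a, b)\<leftarrow>ps. lop UNIV a b) z = (\<Sum>(a, b)\<leftarrow>ps. lop T a b) z)"
  proof (induction ps)
    case Nil
    show ?case by (simp only: list.map sum_list.Nil inner_0) simp
  next
    case (Cons p ps)
    obtain a b where p: "p = (a, b)" by fastforce
    then have "a \<in> T" "b \<in> T" using Cons.prems by auto
    moreover have "(\<Sum>(a, b)\<leftarrow>ps. lop UNIV a b) \<in> inner T"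
      "\<forall>z\<in>T. (\<Sum>(a, b)\<leftarrow>ps. lop UNIV a b) z = (\<Sum>(a, b)\<leftarrow>ps. lop T a b) z"
      using Cons by auto
    moreover have "lop T a b z = lop UNIV a b z" if "z \<in> T" for z
      using that by (simp add: lop_def)
    ultimately show ?case
      by (simp only: p list.map sum_list.Cons prod.case inner_add inner_lop) simp
  qed
  then show "emb_map (\<Sum>(a, b)\<leftarrow>ps. lop T a b, x) = (\<Sum>(a, b)\<leftarrow>ps. lop UNIV a b, x)"
    using extend_eq by (simp add: emb_map_def)
qed

lemma lie_monomorphism_emb_map:
  "lie_monomorphism emb_scale (std_embedding T) (emb_bracket T)
     emb_scale (std_embedding UNIV) (emb_bracket UNIV) emb_map"
  unfolding lie_monomorphism_def
proof (intro conjI ballI allI)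
  show "emb_map ` std_embedding T \<subseteq> std_embedding UNIV"
    unfolding emb_map_image by (rule inner_emb)
  show "inj_on emb_map (std_embedding T)"
  proof (rule inj_onI)
    fix p q assume pq: "p \<in> std_embedding T" "q \<in> std_embedding T" "emb_map p = emb_map q"
    obtain D x E y where eq: "p = (D, x)" "q = (E, y)" and ops: "D \<in> lops T" "E \<in> lops T"
      using pq by (auto simp: std_embedding_def)
    have "D z = E z" for z
      using extend(2)[OF ops(1), of z] extend(2)[OF ops(2), of z] pq(3) lops_outside[OF sub_T ops(1), of z] lops_outside[OF sub_T ops(2), of z]
      by (cases "z \<in> T") (auto simp: eq emb_map_def)
    then show "p = q" using pq(3) by (auto simp: eq emb_map_def)
  qed
next
  fix p q assume "p \<in> std_embedding T" "q \<in> std_embedding T"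
  then obtain D x E y where eq: "p = (D, x)" "q = (E, y)" and
    D: "D \<in> lops T" and E: "E \<in> lops T" and xy: "x \<in> T" "y \<in> T"
    by (auto simp: std_embedding_def)
  have "extend (D + E) = extend D + extend E"
    using extend[OF D] extend[OF E] by (intro extend_eq inner_add) auto
  then show "emb_map (p + q) = emb_map p + emb_map q" by (simp add: eq emb_map_def)
  have "extend ((D \<circ> E) - (E \<circ> D) + lop T x y) =
      (extend D \<circ> extend E) - (extend E \<circ> extend D) + lop UNIV x y"
  proof (rule extend_eq)
    show "(extend D \<circ> extend E) - (extend E \<circ> extend D) + lop UNIV x y \<in> inner T"
      using extend(1)[OF D] extend(1)[OF E] xy inner_T_map[OF _ ideal_T]
      by (intro inner_add inner_comm inner_lop) (auto intro: inner_lops)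
    fix z assume z: "z \<in> T"
    then show "((extend D \<circ> extend E) - (extend E \<circ> extend D) + lop UNIV x y) z =
        ((D \<circ> E) - (E \<circ> D) + lop T x y) z"
      using extend(2)[OF D] extend(2)[OF E] lops_in[OF sub_T] D E by (simp add: lop_def)
  qed
  then show "emb_map (emb_bracket T p q) = emb_bracket UNIV (emb_map p) (emb_map q)"
    using extend(2)[OF D xy(2)] extend(2)[OF E xy(1)] by (simp add: eq emb_map_def emb_bracket_def)
next
  fix c p assume "p \<in> std_embedding T"
  then obtain D x where eq: "p = (D, x)" and D: "D \<in> lops T"
    by (auto simp: std_embedding_def)
  have "extend (op_scale c D) = op_scale c (extend D)"
    using extend[OF D] by (intro extend_eq inner_scale) (auto simp: op_scale_def)
  then show "emb_map (emb_scale c p) = emb_scale c (emb_map p)"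
    by (simp add: eq emb_map_def emb_scale_def)
qed

section \<open>Nondegeneracy of the system of quotients\<close>

context
  assumes nondegenerate_T: "nondegenerate T"
    and two: "\<And>x::'a. x + x = 0 \<Longrightarrow> x = 0" and three: "\<And>x::'a. x + x + x = 0 \<Longrightarrow> x = 0"
begin

lemma nondegenerateD:
  assumes "x \<in> T" "\<And>t. t \<in> T \<Longrightarrow> br x t x = 0"
  shows "x = 0"
proof -
  have "bracket T {x} {x} = {0}"
    using assms(2) by (auto simp: bracket_eq_0_iff br_skew[of x])
  then show ?thesis using nondegenerate_T assms(1) unfolding nondegenerate_def by blast
qed

text \<open>The square of R vanishes on T, so the three terms [R t, R u, t], [R t, u, R t],
  [t, R u, R t] of half its value at [t, u, t] sum to 0. Applying R to [t, u, R t] and [R t, u, t]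
  shows that neighbouring terms also sum to 0; hence [R t, u, R t] = 0.\<close>

lemma derivation_zero_if_into_kernel:
  assumes R: "R \<in> lops UNIV" and I: "ideal_of I T"
    and RI: "\<And>i. i \<in> I \<Longrightarrow> R i = 0" and RT: "\<And>t. t \<in> T \<Longrightarrow> R t \<in> I" and t: "t \<in> T"
  shows "R t = 0"
proof (rule nondegenerateD)
  show "R t \<in> T" using RT[OF t] ideal_subset[OF I] by blast
  fix u assume u: "u \<in> T"
  have "R (br t u (R t)) = 0" "R (br (R t) u t) = 0"
    using RI RT ideal_br[OF I] t u by auto
  then have 1: "br (R t) u (R t) + br t (R u) (R t) = 0" "br (R t) (R u) t + br (R t) u (R t) = 0"
    using RI RT t u by (simp_all add: lops_UNIV[OF R] br_more)
  have "R (R (br t u t)) = 0" using in_T(6) RI RT t u by simp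
  then have "(br (R t) (R u) t + br (R t) u (R t) + br t (R u) (R t)) +
      (br (R t) (R u) t + br (R t) u (R t) + br t (R u) (R t)) = 0"
    using RI RT t u by (simp add: lops_UNIV[OF R] br_more algebra_simps)
  then have "br (R t) (R u) t + br (R t) u (R t) + br t (R u) (R t) = 0" by (rule two)
  then have "br t (R u) (R t) = 0" using 1 by simp
  then show "br (R t) u (R t) = 0" using 1 by simp
qed

lemma emb_two: "z + z = 0 \<Longrightarrow> z = 0" and emb_three: "z + z + z = 0 \<Longrightarrow> z = 0"
  for z :: "('a \<Rightarrow> 'a) \<times> 'a"
proof -
  assume z: "z + z = 0"
  have "fst z x = 0" for x
    by (rule two) (use fun_cong[OF arg_cong[OF z, of fst], of x] in simp)
  moreover have "snd z = 0" by (rule two) (use arg_cong[OF z, of snd] in simp)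
  ultimately show "z = 0" by (simp add: prod_eq_iff fun_eq_iff)
next
  assume z: "z + z + z = 0"
  have "fst z x = 0" for x
    by (rule three) (use fun_cong[OF arg_cong[OF z, of fst], of x] in simp)
  moreover have "snd z = 0" by (rule three) (use arg_cong[OF z, of snd] in simp)
  ultimately show "z = 0" by (simp add: prod_eq_iff fun_eq_iff)
qed

section \<open>Homogeneous sandwich elements of L(S)\<close>

lemma odd_in: "(0, x) \<in> std_embedding UNIV" and even_in: "F \<in> lops UNIV \<Longrightarrow> (F, 0) \<in> std_embedding UNIV"
  by (simp_all add: std_embedding_def lops_0)

lemma emb_00: "emb_bracket UNIV (0, x) (0, y) = (lop UNIV x y, 0)"
  and emb_01: "F \<in> lops UNIV \<Longrightarrow> emb_bracket UNIV (F, 0) (0, x) = (0, F x)"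
  and emb_10: "F \<in> lops UNIV \<Longrightarrow> emb_bracket UNIV (0, x) (F, 0) = (0, - F x)"
  and emb_11: "F \<in> lops UNIV \<Longrightarrow> E \<in> lops UNIV \<Longrightarrow> emb_bracket UNIV (F, 0) (E, 0) = ((F \<circ> E) - (E \<circ> F), 0)"
  by (auto simp: emb_bracket_def fun_eq_iff lops_UNIV lop_UNIV br_more)

text \<open>In L(S) the double bracket [w, [w, t]] of odd elements is -[w, t, w], so nondegeneracy
  of T leaves no nonzero odd sandwich in T.\<close>

lemma emb_sandwich_zero:
  assumes w: "w \<in> T"
    and sq: "\<And>z. z \<in> std_embedding UNIV \<Longrightarrow> emb_bracket UNIV (0, w) (emb_bracket UNIV (0, w) z) = 0"
  shows "w = 0"
proof (rule nondegenerateD[OF w])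
  fix t
  show "br w t w = 0"
    using sq[OF odd_in[of t]] emb_10[OF lop_in[of w UNIV t], of w]
    by (simp add: emb_00 zero_prod_def lop_UNIV)
qed

text \<open>For i in an ideal that c maps into T, first the cubes and then the products of i, i, t
  are odd sandwiches in T, hence zero. This gives c = 0 on the ideal; the second half passes from
  there to T and S.\<close>

lemma even_sandwich_zero:
  assumes c: "c \<in> lops UNIV"
    and sq: "\<And>z. z \<in> std_embedding UNIV \<Longrightarrow> emb_bracket UNIV (c, 0) (emb_bracket UNIV (c, 0) z) = 0"
  shows "c = 0"
proof -
  let ?q = "(c, 0)"
  let ?sym3 = "emb.sym3 ?q"
  note sandwich = emb_two emb_three even_in[OF c] sq
  obtain I where I: "essential T I"
    and cI: "\<And>i. i \<in> I \<Longrightarrow> c i \<in> T" and lop_c: "\<And>i t. i \<in> I \<Longrightarrow> t \<in> T \<Longrightarrow> lop UNIV i (c t) \<in> inner T"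
    using exists_good_op[OF c] by blast
  note II = essential_ideal[OF I]
  note br_I = ideal_br[OF II] and sub = ideal_subspace[OF II]
  have IT: "i \<in> I \<Longrightarrow> i \<in> T" for i using ideal_subset[OF II] by blast
  have sym3: "?sym3 (0, x) (0, y) (0, z) = (0, - c (br y (c z) x))" for x y z
    by (simp add: emb.sym3_def emb_01[OF c] emb_00 emb_10 lop_in lop_UNIV lops_UNIV[OF c])
  have cube: "?sym3 (0, n) (0, n) (0, n) = 0" if n: "n \<in> I" for n
  proof -
    have "- c (br n (c n) n) = 0"
    proof (rule emb_sandwich_zero)
      show "- c (br n (c n) n) \<in> T" using n cI br_I IT in_T(5) by simp
      fix z assume "z \<in> std_embedding UNIV"
      then show "emb_bracket UNIV (0, - c (br n (c n) n)) (emb_bracket UNIV (0, - c (br n (c n) n)) z) = 0"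
        using emb.cube_sandwich[OF sandwich odd_in[of n]] by (simp add: sym3)
    qed
    then show ?thesis by (simp add: sym3 zero_prod_def)
  qed
  have c0: "c i = 0" if i: "i \<in> I" for i
  proof (rule nondegenerateD)
    show ci: "c i \<in> T" using i by (rule cI)
    fix t assume t: "t \<in> T"
    \<comment> \<open>Symmetry puts t into the middle slot; then this p lies in I, as
      \<open>cube\<close> requires for p, i + p and i - p.\<close>
    let ?p = "- br t (c i) i"
    have p: "?p \<in> I" using i ci t br_I subspace_neg[OF sub] by simp
    have "emb_bracket UNIV ?q (0, ?p) = ?sym3 (0, i) (0, t) (0, i)"
      by (simp add: emb_01[OF c] sym3 lops_UNIV[OF c])
    also have "\<dots> = ?sym3 (0, i) (0, i) (0, t)"
      by (rule emb.sym3_commute(2)[OF sandwich]) (auto simp: odd_in)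
    finally have qp: "emb_bracket UNIV ?q (0, ?p) = ?sym3 (0, i) (0, i) (0, t)" .
    have w: "emb_bracket UNIV ?q (0, ?p) = (0, c ?p)" by (rule emb_01[OF c])
    have "c ?p = 0"
    proof (rule emb_sandwich_zero)
      show "c ?p \<in> T" using p by (rule cI)
      fix z assume z: "z \<in> std_embedding UNIV"
      have "?sym3 ((0, i) + (0, ?p)) ((0, i) + (0, ?p)) ((0, i) + (0, ?p)) = 0"
        using cube[OF subspace_add[OF sub i p]] by simp
      moreover have "?sym3 ((0, i) - (0, ?p)) ((0, i) - (0, ?p)) ((0, i) - (0, ?p)) = 0"
        using cube[OF subspace_diff[OF sub i p]] by simp
      ultimately show "emb_bracket UNIV (0, c ?p) (emb_bracket UNIV (0, c ?p) z) = 0"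
        using emb.square_sandwich[OF sandwich odd_in odd_in odd_in z qp cube[OF i] cube[OF p]]
        by (simp only: w)
    qed
    then have "?sym3 (0, i) (0, i) (0, t) = 0" using qp w by (simp add: zero_prod_def)
    then have "emb_bracket UNIV (0, c i) (emb_bracket UNIV (0, c i) (0, t)) = 0"
      using emb.ad_square[OF sandwich odd_in odd_in, of i t] by (simp add: emb_01[OF c])
    then show "br (c i) t (c i) = 0"
      by (simp add: emb_00 emb_10 lop_in lop_UNIV zero_prod_def)
  qed
  note c_br = lops_UNIV(6)[OF c] and cIT = lop_c[THEN inner_T_map[OF _ ideal_T], unfolded lop_UNIV]
  have ct: "br i (c t) u = c (br i t u) - br i t (c u)" if "i \<in> I" for i t u
    using that by (simp add: c_br c0 br_more)
  \<comment> \<open>It remains to see that the commutators \<open>[c, [j, t]] = [j, c t]\<close> vanish on \<open>T\<close> for \<open>j \<in> [T, I, I]\<close>: they annihilate \<open>I\<close> and map \<open>T\<close> into \<open>I\<close>.\<close>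
  let ?J = "bracket T I I"
  have J: "essential T ?J" by (intro essential_bracket sub_T semiprime_T I)
  have JI: "j \<in> ?J \<Longrightarrow> j \<in> I" for j using bracket_subset_ideal[OF II] by blast
  \<comment> \<open>For a single j in I the bracket is only known to lie in T; the product [u, j, k]
    supplies a second factor from I.\<close>
  have "br (br u j k) t (c t') \<in> I" if u: "u \<in> T" and j: "j \<in> I" and k: "k \<in> I" and t: "t \<in> T" "t' \<in> T" for u j k t t'
  proof -
    have kt: "br k t (c t') = - br k (c t) t'" if "t \<in> T" for t
      using ct[OF k, of t t'] c0 br_I(1)[OF k that t(2)] by simp
    have 1: "br u j (br k t (c t')) \<in> I"
      using cIT[OF k t] u j br_I(2) in_T(5) by (simp add: kt[OF t(1)])
    have 2: "br k (br u j t) (c t') = 0"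
      using kt[OF IT] br_I u j t c0 by (simp add: br_more)
    have "br u j (c t') = br j (c u) t'"
      using ct[OF j, of u t'] c0 br_I j u t br_skew[of u j "c t'"] by simp
    then have 3: "br k t (br u j (c t')) \<in> I"
      using cIT[OF j u t(2)] k t br_I by simp
    have "br (br u j k) t (c t') = br u j (br k t (c t')) - br k (br u j t) (c t') - br k t (br u j (c t'))"
      using derivation[of u j k t "c t'"] by (simp add: algebra_simps)
    then show ?thesis using 1 2 3 subspace_diff[OF sub] by simp
  qed
  then have "?J \<subseteq> {j. br j t (c t') \<in> I}" if "t \<in> T" "t' \<in> T" for t t'
    using that sub by (subst bracket_subset_iff) (auto simp: subspace_def br_linear br_more)
  then have JtI: "br j t (c t') \<in> I" if "j \<in> ?J" "t \<in> T" "t' \<in> T" for j t t'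
    using that by blast
  show "c = 0"
  proof (rule derivation_zero_if_essential[OF c J])
    show "c j = 0" if "j \<in> ?J" for j using that JI c0 by blast
    fix j t u assume j: "j \<in> ?J" and t: "t \<in> T" and u: "u \<in> T"
    have "lop UNIV j (c t) u = 0"
    proof (rule derivation_zero_if_into_kernel[OF lop_in II _ _ u])
      fix i assume i: "i \<in> I"
      show "lop UNIV j (c t) i = 0"
        using ct[OF JI[OF j], of t i] c0 br_I(1)[OF JI[OF j] t IT[OF i]] i
        by (simp add: lop_UNIV br_more)
    next
      fix t' assume t': "t' \<in> T"
      have "br j (c t) t' = - br j t (c t')"
        using ct[OF JI[OF j], of t t'] c0 br_I(1)[OF JI[OF j] t t'] by simp
      then show "lop UNIV j (c t) t' \<in> I"
        using JtI[OF j t t'] subspace_neg[OF sub] by (simp add: lop_UNIV)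
    qed auto
    then show "br j (c t) u = 0" by (simp add: lop_UNIV)
  qed
qed

section \<open>Elements s with [S, s, s] = 0\<close>

context
  fixes s assumes s: "\<And>x. br x s s = 0"
begin

lemma s_mid: "br s x s = 0"
  using s[of x] br_skew[of s x s] by simp

text \<open>This is [x, s, s] = 0 differentiated along E; the elements E s act as tangent vectors at
  s.\<close>

lemma tangent:
  assumes "E \<in> lops UNIV"
  shows "br x (E s) s = - br x s (E s)"
  using arg_cong[OF s[of x], of E] s[of "E x"] lops_UNIV[OF assms]
  by (simp add: eq_neg_iff_add_eq_0)

lemma tangent_br:
  assumes "\<And>x. br x e s = - br x s e"
  shows "br s e x = br s x e + br s x e"
proof -
  have "br e x s = br x s e" using br_skew[of e x s] assms[of x] by simp
  moreover have "br x s e = - br s x e" by (rule br_skew)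
  ultimately show ?thesis using br_cyclic[of s e x] by simp
qed

text \<open>Using \<open>tangent_br\<close> for e and for b gives [s, e, b] = 4 [s, e, b].\<close>

lemma tangent_pair:
  assumes "\<And>x. br x e s = - br x s e" "\<And>x. br x b s = - br x s b"
  shows "br s e b = 0"
  using tangent_br[OF assms(1), of b] tangent_br[OF assms(2), of e] three[of "br s e b"] by simp

text \<open>The operator c = [s, D s, -] satisfies c c = 0 and c E c = 0 for every E in L(S, S), so
  it is an even sandwich and vanishes.\<close>

lemma inner_sandwich:
  assumes D: "D \<in> lops UNIV"
  shows "br s (D s) x = 0"
proof -
  let ?b = "D s"
  note b = tangent[OF D]
  define c where "c = lop UNIV s ?b"
  have cx: "c x = br s ?b x" for x by (simp add: c_def lop_UNIV)
  have c: "c \<in> lops UNIV" by (simp add: c_def lop_in)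
  note c_der = lops_UNIV[OF c]
  have c_twice: "c y = br s y ?b + br s y ?b" for y unfolding cx by (rule tangent_br[OF b])
  have cs: "c s = 0" by (simp add: cx s_mid)
  have ce: "c (E s) = 0" if "E \<in> lops UNIV" for E
    unfolding cx by (rule tangent_pair[OF b tangent[OF that]])
  \<comment> \<open>The derivation rules evaluate the bracket to -h, while \<open>c_twice\<close>
    evaluates it to 2 h.\<close>
  have sc: "br s (c u) x = 0" for u x
  proof -
    let ?h = "br s (br s u ?b) x"
    have "br s (c u) x = c (br s u x) - br s u (c x)"
      by (simp add: c_der cs br_more)
    moreover have "br s u (c x) = ?h + c (br s u x)"
      using derivation[of s u s ?b x] by (simp add: cx s_mid br_more)
    ultimately have 1: "br s (c u) x = - ?h" by simp
    have "br s (c u) x = ?h + ?h" by (simp add: c_twice br_linear)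
    then have "?h + ?h + ?h = 0" using 1 by (metis left_minus)
    then show ?thesis using 1 three by (metis neg_0_equal_iff_equal)
  qed
  have cc: "c (c y) = 0" for y
    using c_twice[of "c y"] sc by simp
  \<comment> \<open>Applying c to E (c y), and E to c (c y) = 0, shows that one expression equals
    both c (E (c y)) and its negative.\<close>
  have cEc: "c (E (c y)) = 0" if E: "E \<in> lops UNIV" for E y
  proof (rule two)
    have E_c: "E (c y) = br (E s) ?b y + br s (E ?b) y + c (E y)" for y
      by (simp add: cx lops_UNIV[OF E])
    let ?x = "br (E s) ?b (c y) + br s (E ?b) (c y)"
    have "c (E (c y)) = ?x"
      unfolding E_c[of y] using ce[OF E] ce[OF D] sc[of "E ?b"]
      by (simp add: c_der cc cs br_more)
    moreover have "?x + c (E (c y)) = 0"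
      using E_c[of "c y"] by (simp only: cc lops_UNIV(4)[OF E])
    ultimately show "c (E (c y)) + c (E (c y)) = 0" by (simp only:)
  qed
  have "c = 0"
  proof (rule even_sandwich_zero[OF c])
    fix z assume "z \<in> std_embedding UNIV"
    then obtain E u where z: "z = (E, u)" and E: "E \<in> lops UNIV" by (auto simp: std_embedding_def)
    show "emb_bracket UNIV (c, 0) (emb_bracket UNIV (c, 0) z) = 0"
      by (auto simp: z emb_bracket_def zero_prod_def fun_eq_iff lop_UNIV br_more cc cEc[OF E]
          c_der lops_UNIV[OF E])
  qed
  then show ?thesis using cx by simp
qed

text \<open>By \<open>inner_sandwich\<close> the odd element s is itself a sandwich. Cubes of even
  elements are then even sandwiches, hence zero, so the product of F, F, u is a sandwich. Up to sign
  it is the double bracket of F s with u, lies in T, and vanishes.\<close>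

lemma op_s_zero:
  assumes F: "F \<in> lops UNIV" and FT: "F s \<in> T"
  shows "F s = 0"
proof (rule nondegenerateD[OF FT])
  fix u assume u: "u \<in> T"
  let ?q = "(0, s)"
  let ?sym3 = "emb.sym3 ?q"
  have sq: "emb_bracket UNIV ?q (emb_bracket UNIV ?q z) = 0" if zQ: "z \<in> std_embedding UNIV" for z
  proof -
    obtain E v where z: "z = (E, v)" and E: "E \<in> lops UNIV" using zQ by (auto simp: std_embedding_def)
    show ?thesis
      using inner_sandwich[OF E]
      by (auto simp: z emb_bracket_odd[OF E] emb_bracket_odd[OF lop_in] zero_prod_def fun_eq_iff
          lop_UNIV br_more s_mid)
  qed
  note sandwich = emb_two emb_three odd_in sq
  have cube: "?sym3 (F, 0) (F, 0) (F, 0) = 0" if F: "F \<in> lops UNIV" for F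
  proof -
    have *: "?sym3 (F, 0) (F, 0) (F, 0) = (lop UNIV s (- F (F (F s))), 0)"
      by (simp add: emb.sym3_def emb_00 emb_10[OF F] emb_01[OF F] lops_UNIV[OF F])
    have "lop UNIV s (- F (F (F s))) = 0"
    proof (rule even_sandwich_zero[OF lop_in])
      fix z assume "z \<in> std_embedding UNIV"
      then show "emb_bracket UNIV (lop UNIV s (- F (F (F s))), 0)
          (emb_bracket UNIV (lop UNIV s (- F (F (F s))), 0) z) = 0"
        using emb.cube_sandwich[OF sandwich even_in[OF F]] by (simp only: *)
    qed auto
    then show ?thesis by (simp only: * zero_prod_def)
  qed
  define p where "p = emb_bracket UNIV (F, 0) (emb_bracket UNIV (F, 0) (emb_bracket UNIV ?q (0, u)))"
  have comm: "(D \<circ> E) - (E \<circ> D) \<in> lops UNIV" if "D \<in> lops UNIV" "E \<in> lops UNIV" for D E :: "'a \<Rightarrow> 'a"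
    using that by (rule comm_in[OF subsystem_UNIV])
  obtain P where p: "p = (P, 0)" and P: "P \<in> lops UNIV"
    using comm[OF F] lop_in[of s UNIV u] by (simp add: p_def emb_00 emb_11[OF F])
  have w: "emb_bracket UNIV ?q p = ?sym3 (F, 0) (F, 0) (0, u)"
    by (simp only: p_def emb.sym3_def)
  have r: "emb_bracket UNIV ?q (F, 0) = (0, - F s)" by (rule emb_10[OF F])
  have "emb_bracket UNIV (0, - F s) (emb_bracket UNIV (0, - F s) (0, u)) = - ?sym3 (F, 0) (F, 0) (0, u)"
    using emb.ad_square[OF sandwich even_in[OF F] odd_in, of u] by (simp only: r)
  then have ww: "emb_bracket UNIV ?q p = (0, br (F s) u (F s))"
    by (simp add: w emb_00 emb_10 lop_in lop_UNIV br_more) (simp add: prod_eq_iff)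
  show "br (F s) u (F s) = 0"
  proof (rule emb_sandwich_zero)
    show "br (F s) u (F s) \<in> T" using FT u in_T(6) by simp
    fix z assume z: "z \<in> std_embedding UNIV"
    have "?sym3 ((F, 0) + p) ((F, 0) + p) ((F, 0) + p) = 0"
      using cube[OF lops_add[OF F P]] by (simp only: p add_Pair add_0_left)
    moreover have "?sym3 ((F, 0) - p) ((F, 0) - p) ((F, 0) - p) = 0"
      using cube[OF lops_diff[OF F P]] by (simp only: p diff_Pair diff_0_right)
    moreover have "?sym3 p p p = 0" using cube[OF P] by (simp only: p)
    moreover have "p \<in> std_embedding UNIV" using even_in[OF P] by (simp only: p)
    ultimately show "emb_bracket UNIV (0, br (F s) u (F s)) (emb_bracket UNIV (0, br (F s) u (F s)) z) = 0"
      using emb.square_sandwich[OF sandwich even_in[OF F] odd_in _ z w cube[OF F]]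
      by (simp only: ww)
  qed
qed

text \<open>The expression is symmetric in x and y, by \<open>inner_sandwich\<close> for [x, y, -],
  and skew, as it is the commutator of [s, x, -] and [s, y, -] applied to z.\<close>

lemma br_s_br_s: "br s (br s x y) z = 0"
proof (rule two)
  have "br x y s = br s y x - br s x y"
    using br_cyclic[of x y s] br_skew[of y s x] by simp
  then have "br s (br s x y) z = br s (br s y x) z"
    using inner_sandwich[OF lop_in[of x UNIV y], of z] by (simp add: lop_UNIV br_more)
  moreover have "br s (br s u v) z = br s u (br s v z) - br s v (br s u z)" for u v
    using derivation[of s u s v z] by (simp add: s_mid br_more)
  ultimately have "br s (br s x y) z + br s (br s x y) z =
      (br s x (br s y z) - br s y (br s x z)) + (br s y (br s x z) - br s x (br s y z))"
    by metis
  then show "br s (br s x y) z + br s (br s x y) z = 0" by simp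
qed

text \<open>On (T : s) the brackets [i, t, s] vanish by \<open>op_s_zero\<close>. The brackets
  [s, y, t] are killed first for y = t in I1, then by polarization for two entries in I1, and
  finally for y in I2 and t in T.\<close>

lemma s_zero: "s = 0"
proof -
  define I where "I = colon T s"
  define J where "J = bracket T I I"
  define I1 where "I1 = bracket T J J"
  define J1 where "J1 = bracket T I1 I1"
  define I2 where "I2 = bracket T J1 J1"
  have I: "essential T I" unfolding I_def by (intro essential_colon sub_T quotients_T)
  have ess: "essential T I" "essential T J" "essential T I1" "essential T J1" "essential T I2"
    unfolding I2_def J1_def I1_def J_def by (intro essential_bracket sub_T semiprime_T I)+
  note id = ess[THEN essential_ideal]
  have sub: "J \<subseteq> I" "I1 \<subseteq> J" "J1 \<subseteq> I1" "I2 \<subseteq> J1"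
    unfolding I2_def J1_def I1_def J_def
    using bracket_subset_ideal id by (auto simp: I2_def J1_def I1_def J_def)
  have IT: "i \<in> I \<Longrightarrow> i \<in> T" for i using ideal_subset[OF id(1)] by blast
  note br_I = ideal_br[OF id(1)]
  have it: "br i t s = 0" if "i \<in> I" "t \<in> T" for i t
    using op_s_zero[OF lop_in, of i t] br_colon(1)[OF subspace_T _ that(2) generated_base] that
    by (simp add: lop_UNIV I_def)
  have sym: "br s x y = br s y x" if "x \<in> T" "y \<in> T" "x \<in> I \<or> y \<in> I" for x y
  proof -
    have "br x y s = 0" using it that br_skew[of x y s] by auto
    then show ?thesis using br_cyclic[of x y s] br_skew[of y s x] by (simp add: algebra_simps)
  qed
  have "lop UNIV i s \<in> inner I" if "i \<in> I1" for i
    using lop_inner_ideal[OF id(1) _ generated_base] that by (simp add: I1_def J_def I_def)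
  then have sI: "br s i t \<in> I" if "i \<in> I1" "t \<in> T" for i t
    using that inner_map[OF _ id(1), of "lop UNIV i s" t] br_skew[of s i t]
      subspace_neg[OF ideal_subspace[OF id(1)]] by (simp add: lop_UNIV)
  have cc: "br s c c = 0" if c: "c \<in> I1" for c
  proof (rule nondegenerateD)
    let ?t = "br s c c"
    have cI: "c \<in> I" using c sub by blast
    note cT = IT[OF cI]
    show tT: "?t \<in> T" using sI[OF c cT] IT by blast
    have tI: "?t \<in> I" using sI[OF c cT] .
    fix b assume b: "b \<in> T"
    let ?m = "br s c b"
    have mI: "?m \<in> I" using sI[OF c b] .
    note mT = IT[OF mI]
    have m: "br s b c = ?m" using sym[OF b cT] cI by simp
    have 0: "br s c ?t = 0" "br s b ?t = 0" "br s c ?m = 0"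
      using sym[OF cT tT] sym[OF b tT] sym[OF cT mT] cI tI by (simp_all add: br_s_br_s)
    \<comment> \<open>Here [x, y, [s, c, c]] is expanded by [x, y, -], which kills s, and [s, c,
      [x, y, c]] by [s, c, -].\<close>
    have key: "br x y ?t + (br (br s c x) y c + br x (br s c y) c)
        + (br (br s c x) y c + br x (br s c y) c) = 0"
      if x: "x \<in> I" and y: "y \<in> T" for x y
    proof -
      have "br s (br x y c) c = br s c (br x y c)"
        using sym[of c "br x y c"] cT cI br_I(1)[OF x y cT] IT by simp
      then have "br x y ?t = br s c (br x y c) + br s c (br x y c)"
        using derivation[of x y s c c] it[OF x y] by (simp add: br_more)
      then show ?thesis
        using derivation[of s c x y c] by (simp add: algebra_simps)
    qed
    have 1: "br ?t b ?t + br ?t ?m c + br ?t ?m c = 0"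
      using key[OF tI b] by (simp add: 0 br_more)
    have 2: "br ?m c ?t + br ?m ?t c + br ?m ?t c = 0"
      using key[OF mI cT] by (simp add: 0 br_more)
    have "br s (br c ?t b) c = br s c (br c ?t b)"
      using sym[of c "br c ?t b"] cT cI br_I(1)[OF cI tT b] IT by simp
    then have "br c ?t ?m = br s c (br c ?t b) + br s b (br c ?t c)"
      using derivation[of c ?t s b c] it[OF cI tT] by (simp add: m br_more)
    moreover have "br s c (br c ?t b) = br c ?t ?m"
      using derivation[of s c c ?t b] by (simp add: 0 alternating br_more)
    moreover have "br s b (br c ?t c) = br ?m ?t c + br c ?t ?m"
      using derivation[of s b c ?t c] by (simp add: 0 m br_more)
    ultimately have 3: "br c ?t ?m = - br ?m ?t c"
      by (simp add: algebra_simps eq_neg_iff_add_eq_0)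
    have "br ?m ?t c = - br ?t ?m c" by (rule br_skew)
    \<comment> \<open>The three terms of the Jacobi identity for \<open>t, m, c\<close> are \<open>[t, m, c]\<close>, \<open>2 [t, m, c]\<close> and \<open>[t, m, c]\<close>.\<close>
    then have "(br ?t ?m c + br ?t ?m c) + (br ?t ?m c + br ?t ?m c) = 0"
      using 2 3 cyclic[of ?t ?m c] by (simp add: algebra_simps)
    then have "br ?t ?m c = 0" using two by blast
    then show "br ?t b ?t = 0" using 1 by simp
  qed
  have cd: "br s c d = 0" if "c \<in> I1" "d \<in> I1" for c d
  proof (rule two)
    have "br s (c + d) (c + d) = 0"
      using that subspace_add[OF ideal_subspace[OF id(3)]] by (intro cc)
    moreover have "c \<in> I" "d \<in> I" using that sub by auto
    then have "br s d c = br s c d" using sym[of d c] IT by simp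
    ultimately show "br s c d + br s c d = 0" using cc that by (simp add: br_linear)
  qed
  have sy: "br s y t = 0" if y: "y \<in> I2" and t: "t \<in> T" for y t
  proof -
    have "lop UNIV s y t = 0"
    \<comment> \<open>By \<open>cd\<close> the derivation [s, y, -] kills I1, and the two further
      products defining I2 make it map T into I1.\<close>
    proof (rule derivation_zero_if_into_kernel[OF lop_in id(3) _ _ t])
      show "lop UNIV s y i = 0" if "i \<in> I1" for i
        using cd[of y i] that y sub by (auto simp: lop_UNIV)
      have "lop UNIV y s \<in> inner I1"
        using lop_inner_ideal[OF id(3) _ generated_base] y sub by (auto simp: I2_def J1_def I_def)
      then show "lop UNIV s y u \<in> I1" if "u \<in> T" for u
        using that inner_map[OF _ id(3), of "lop UNIV y s" u] br_skew[of s y u]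
          subspace_neg[OF ideal_subspace[OF id(3)]] by (simp add: lop_UNIV)
    qed auto
    then show ?thesis by (simp add: lop_UNIV)
  qed
  show "s = 0"
  proof (rule zero_if_essential[OF ess(5)])
    fix y t assume yt: "y \<in> I2" "t \<in> T"
    show "br y s t = 0" using sy[OF yt] br_skew[of y s t] by simp
    show "br y t s = 0" using it yt sub by blast
  qed
qed

end

theorem nondegenerate_UNIV: "nondegenerate UNIV"
  unfolding nondegenerate_def bracket_eq_0_iff using s_zero by blast

end

end

section \<open>Cancellation of 2 and 3 from the characteristic, and assembly of both claims\<close>

theorem theorem3p19:
  fixes scale :: "'f::field \<Rightarrow> 'a::ab_group_add \<Rightarrow> 'a"
    and br :: "'a \<Rightarrow> 'a \<Rightarrow> 'a \<Rightarrow> 'a"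
    and T :: "'a set"
  assumes "lie_triple_system scale br"
    and "lie_triple_system.subsystem scale br T"
    and "lie_triple_system.semiprime scale br T"
    and "lie_triple_system.system_of_quotients scale br T"
  shows "(\<exists>\<iota>. lie_triple_system.canonical_map br T \<iota> \<and>
            lie_monomorphism
              (lie_triple_system.emb_scale scale)
              (lie_triple_system.std_embedding scale br T)
              (lie_triple_system.emb_bracket br T)
              (lie_triple_system.emb_scale scale)
              (lie_triple_system.std_embedding scale br UNIV)
              (lie_triple_system.emb_bracket br UNIV) \<iota> \<and>
            algebra_of_quotients
              (lie_triple_system.emb_scale scale)
              (lie_triple_system.std_embedding scale br UNIV)
              (lie_triple_system.emb_bracket br UNIV)
              (\<iota> ` lie_triple_system.std_embedding scale br T)) \<and>
         (lie_triple_system.nondegenerate scale br T \<and> CHAR('f) \<noteq> 2 \<and> CHAR('f) \<noteq> 3 \<longrightarrow>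
            lie_triple_system.nondegenerate scale br UNIV)"
proof -
  interpret lie_triple_system scale br by fact
  interpret quotient_system scale br T by unfold_locales fact+
  have nz: "(of_nat n :: 'f) \<noteq> 0" if n: "n = 2 \<or> n = 3" and "CHAR('f) \<noteq> n" for n
  proof
    assume "(of_nat n :: 'f) = 0"
    then have "CHAR('f) dvd n" by (simp add: of_nat_eq_0_iff_char_dvd)
    moreover from this n have "CHAR('f) \<le> 3" by (auto dest!: dvd_imp_le)
    then have "CHAR('f) = 0 \<or> CHAR('f) = 1 \<or> CHAR('f) = 2 \<or> CHAR('f) = 3" by linarith
    ultimately show False using n that(2) CHAR_not_1[where 'a = 'f] by auto
  qed
  have cancel: "x = 0" if "scale (of_nat n) x = 0" "n = 2 \<or> n = 3" "CHAR('f) \<noteq> n" for n x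
    using that nz by simp
  have "nondegenerate UNIV" if "nondegenerate T" "CHAR('f) \<noteq> 2" "CHAR('f) \<noteq> 3"
  proof (rule nondegenerate_UNIV[OF that(1)])
    fix x :: 'a
    show "x = 0" if "x + x = 0"
      using cancel[of 2 x] that \<open>CHAR('f) \<noteq> 2\<close> scale_left_distrib[of 1 1 x] by simp
    show "x = 0" if "x + x + x = 0"
      using cancel[of 3 x] that \<open>CHAR('f) \<noteq> 3\<close> scale_left_distrib[of 2 1 x] scale_left_distrib[of 1 1 x] by simp
  qed
  moreover have "canonical_map T emb_map" by (rule canonical_emb_map)
  ultimately show ?thesis
    using lie_monomorphism_emb_map algebra_of_quotients_inner emb_map_image by metis
qed

end
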